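(* Assume (A1), (C1), (C2), and let $\{h_n\}_{n\ge1}$ be any kernel bandwidth sequence satisfying assumption (B). Then, with probability $1$, the misclassification error of the plug-in classifier $F_n^{PI}$ satisfies $$R\big(F_n^{PI}\big)\le\frac{2}{n^2}\sum_{l,m=1}^n\theta_{lm}\,G_{lm,h_n}+\mathcal O(h_n^{\gamma}),$$ where $\theta_{lm}=\mathbf 1_{\{Y_l\neq Y_m\}}$ and $$G_{lm,h_n}=G_{h_n}(X_l,X_m),\qquad G_h(x,y)=\frac{K_h(x-y)}{\hat f_{n,h}^{1/2}(x)\,\hat f_{n,h}^{1/2}(y)} .$$
   Context: Setting: $(X,Y)$ is a random couple with $X\in\mathcal X\subset[-M_0,M_0]^d\subset\mathbb R^d$ and $Y\in\{1,\dots,Q\}$; $(X_1,Y_1),(X_2,Y_2),\dots$ are i.i.d. copies of $(X,Y)$. $f$ is the density of $X$, $\eta^{(i)}(x)=P[Y=i\mid X=x]$, $\pi^{(i)}=P[Y=i]$ and $f^{(i)}$ is the class-conditional density of class $i$, so $f=\sum_i\pi^{(i)}f^{(i)}$; all these functions are measurable. Kernel: $K(x)=(2\pi)^{-d/2}e^{-\|x\|^2/2}$, $K_h(x)=h^{-d}K(x/h)$. Kernel density estimator: $\hat f_{n,h}(x)=\frac1n\sum_{l=1}^nK_h(x-X_l)$. Plug-in classifier: $F_n^{PI}(x)=\arg\max_{1\le i\le Q}\hat\eta_n^{(i)}(x)$ with $\hat\eta_n^{(i)}(x)=\dfrac{\sum_{l=1}^nK_{h_n}(x-X_l)\mathbf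 1_{\{Y_l=i\}}}{n\hat f_{n,h_n}(x)}$. For fixed training data $\{(X_l,Y_l)\}_{l=1}^n$, its misclassification error is $R(F_n^{PI})=P(F_n^{PI}(X)\ne Y)$, the probability being over a new independent pair $(X,Y)$. Assumptions: (A1) $0<f_{\min}\le f\le f_{\max}$. (C1) $0<f^{(i)}_{\min}\le f^{(i)}\le f^{(i)}_{\max}$ for $1\le i\le Q$. (C2) There are $\gamma>0$ and constants $c_i$ with $|f^{(i)}(x)-f^{(i)}(y)|\le c_i\|x-y\|^\gamma$ for all $x,y$ and $1\le i\le Q$. (B) $h_n\searrow0$; $\frac{-\log h_n}{nh_n^{d+2\gamma}}\to0$; $\frac{-\log h_n}{\log\log n}\to\infty$; and $h_n^d<a\,h_{2n}^d$ for some $a>0$. $\mathcal O(h_n^\gamma)$ denotes a term bounded by a constant multiple of $h_n^\gamma$ for all sufficiently large $n$. *)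

theory Defs
  imports "HOL-Probability.Probability"
begin

definition gauss_kernel :: "real ^ 'd \<Rightarrow> real" where
  "gauss_kernel x = (2 * pi) powr (- real CARD('d) / 2) * exp (- (norm x)\<^sup>2 / 2)"

definition scaled_kernel :: "real \<Rightarrow> real ^ 'd \<Rightarrow> real" where
  "scaled_kernel h x = gauss_kernel (x /\<^sub>R h) / h ^ CARD('d)"

text \<open>A training sample of size \<open>n\<close> is given by sequences \<open>xs\<close> and \<open>ys\<close>, of which only
  the entries with indices \<open>1, \<dots>, n\<close> are used.\<close>

definition kde :: "nat \<Rightarrow> real \<Rightarrow> (nat \<Rightarrow> real ^ 'd) \<Rightarrow> real ^ 'd \<Rightarrow> real" where
  "kde n h xs x = (1 / real n) * (\<Sum>l = 1..n. scaled_kernel h (x - xs l))"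

definition eta_hat ::
  "nat \<Rightarrow> real \<Rightarrow> (nat \<Rightarrow> real ^ 'd) \<Rightarrow> (nat \<Rightarrow> nat) \<Rightarrow> nat \<Rightarrow> real ^ 'd \<Rightarrow> real" where
  "eta_hat n h xs ys i x =
     (\<Sum>l = 1..n. scaled_kernel h (x - xs l) * of_bool (ys l = i)) / (real n * kde n h xs x)"

text \<open>The arg max need not be unique, so this is a predicate: \<open>F\<close> may break ties in any way
  that makes it Borel measurable, so that its misclassification error is defined.\<close>

definition plugin_classifier ::
  "nat \<Rightarrow> nat \<Rightarrow> real \<Rightarrow> (nat \<Rightarrow> real ^ 'd) \<Rightarrow> (nat \<Rightarrow> nat) \<Rightarrow> (real ^ 'd \<Rightarrow> nat) \<Rightarrow> bool" where
  "plugin_classifier Q n h xs ys F \<longleftrightarrow>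
     F \<in> measurable borel (count_space UNIV) \<and>
     (\<forall>x. is_arg_max (\<lambda>i. eta_hat n h xs ys i x) (\<lambda>i. i \<in> {1..Q}) (F x))"

lemma scaled_kernel_measurable [measurable]: "scaled_kernel h \<in> borel_measurable borel"
  unfolding scaled_kernel_def[abs_def] gauss_kernel_def by measurable

lemma eta_hat_measurable [measurable]: "eta_hat n h xs ys i \<in> borel_measurable borel"
  unfolding eta_hat_def[abs_def] kde_def by measurable

lemma plugin_classifier_exists:
  assumes "Q \<ge> 1"
  shows "\<exists>F. plugin_classifier Q n h xs ys F"
proof -
  let ?P = "\<lambda>i x. is_arg_max (\<lambda>i. eta_hat n h xs ys i x) (\<lambda>i. i \<in> {1..Q}) i"
  have meas: "(\<lambda>x. LEAST i. ?P i x) \<in> measurable borel (count_space UNIV)"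
    unfolding is_arg_max_def atLeastAtMost_iff by measurable
  have "?P (LEAST i. ?P i x) x" for x
  proof (rule LeastI_ex)
    let ?f = "\<lambda>i. eta_hat n h xs ys i x"
    have "Max (?f ` {1..Q}) \<in> ?f ` {1..Q}"
      using assms by (intro Max_in) auto
    then obtain i where "i \<in> {1..Q}" "?f i = Max (?f ` {1..Q})" by auto
    then show "\<exists>i. ?P i x"
      by (intro exI[of _ i]) (auto simp: is_arg_max_def not_less)
  qed
  with meas show ?thesis
    unfolding plugin_classifier_def by blast
qed

text \<open>The error of a fixed classifier: the training data enter only through \<open>F\<close>, and the
  probability is taken over the pair \<open>(X, Y)\<close> alone.\<close>

definition misclassification_error ::
  "'w measure \<Rightarrow> ('w \<Rightarrow> 'x) \<Rightarrow> ('w \<Rightarrow> nat) \<Rightarrow> ('x \<Rightarrow> nat) \<Rightarrow> real" where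
  "misclassification_error M X Y F = measure M {\<omega> \<in> space M. F (X \<omega>) \<noteq> Y \<omega>}"

definition theta :: "nat \<Rightarrow> nat \<Rightarrow> real" where
  "theta y y' = of_bool (y \<noteq> y')"

definition G_sim ::
  "nat \<Rightarrow> real \<Rightarrow> (nat \<Rightarrow> real ^ 'd) \<Rightarrow> real ^ 'd \<Rightarrow> real ^ 'd \<Rightarrow> real" where
  "G_sim n h xs x y = scaled_kernel h (x - y) / (sqrt (kde n h xs x) * sqrt (kde n h xs y))"

definition bandwidth_condition :: "nat \<Rightarrow> real \<Rightarrow> (nat \<Rightarrow> real) \<Rightarrow> bool" where
  "bandwidth_condition d \<gamma> h \<longleftrightarrow>
     (\<forall>n\<ge>1. 0 < h n) \<and> (\<forall>n\<ge>1. h (Suc n) \<le> h n) \<and> h \<longlonglongrightarrow> 0 \<and>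
     (\<lambda>n. - ln (h n) / (real n * h n powr (real d + 2 * \<gamma>))) \<longlonglongrightarrow> 0 \<and>
     filterlim (\<lambda>n. - ln (h n) / ln (ln (real n))) at_top sequentially \<and>
     (\<exists>a>0. \<forall>n\<ge>1. h n ^ d < a * h (2 * n) ^ d)"

end

theory Submission
  imports Defs "HOL-Real_Asymp.Real_Asymp"
begin

text \<open>
  Consistency suffices, because the factor 2 leaves room. Write \<open>g\<^sub>i = \<pi>\<^sup>(\<^sup>i\<^sup>) f\<^sup>(\<^sup>i\<^sup>)\<close> and
  \<open>f = \<Sum> g\<^sub>i\<close>. A classifier maximising estimates that are close to the \<open>g\<^sub>i\<close> has error at most
  \<open>W = \<Sum> \<integral> g\<^sub>i (f - g\<^sub>i) / f\<close> up to \<open>o(1)\<close>, as \<open>1 - max \<eta>\<^sub>i \<le> 1 - \<Sum> \<eta>\<^sub>i\<^sup>2\<close>, while the lower limit of the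
  normalised similarity sum is almost surely at least \<open>3/4 W\<close>, so that twice the sum is eventually at
  least \<open>1.3 W\<close>. If two classes have positive probability, the lower bounds on the class densities
  give \<open>W > 0\<close>, so the bound holds eventually without any remainder; if there is only one class,
  the classifier makes no error.

  No regularity of the support is available, so kernel estimates need not be close to the densities
  near its boundary. They are compared with the densities only in \<open>L\<^sup>1\<close>, whereas their deviation
  from their means is uniform: Bernstein's inequality on a polynomially fine grid, the Lipschitz
  continuity of the kernel and Borel--Cantelli, using that \<open>n h\<^sub>n\<^sup>d \<ge> (ln n)\<^sup>2\<close> eventually.
\<close>

section \<open>The Gaussian kernel\<close>

text \<open>The similarity sum resists a direct limit for two reasons: its terms share the random
  normalisers \<open>kde\<close>, and its inner sums are evaluated at sample points, so they are not
  independent sums at a fixed point. As only a lower bound is wanted, an upper bound on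
  \<open>kde\<close> suffices: its mean plus a constant \<delta>. This turns the normalisers into
  deterministic bounded weights \<rho>. The sum over \<open>m\<close> is then a kernel estimate with
  weights \<rho>, and concentration uniform in the point lets its mean replace it even though the
  point belongs to the sample; the remaining sum over \<open>l\<close> is an ordinary sample mean.
  The expectation of the latter tends to the sum of the integrals of g_i (f - g_i) / (f + \<delta>).
  Where f is at least \<open>c\<close>, the choice \<delta> = c/3 gives the factor 3/4. The shift by
  \<delta> also makes the inverse square root Lipschitz, so L^1 convergence of the smoothed density
  passes to the weights. In the plug-in rule the random denominator cancels, being common to all
  classes.\<close>

lemma gauss_kernel_pos: "0 < gauss_kernel x"
  by (simp add: gauss_kernel_def)


lemma gauss_kernel_nonneg [simp]: "0 \<le> gauss_kernel x"
  by (simp add: gauss_kernel_def)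

lemma abs_gauss_kernel [simp]: "\<bar>gauss_kernel x\<bar> = gauss_kernel x"
  by simp

lemma gauss_kernel_const_le_1: "(2 * pi) powr (- real n / 2) \<le> 1"
proof -
  have "(2 * pi) powr (- real n / 2) \<le> (2 * pi) powr 0"
    using pi_ge_two by (intro powr_mono) auto
  then show ?thesis by simp
qed

lemma gauss_kernel_le_1: "gauss_kernel x \<le> 1"
  unfolding gauss_kernel_def
  by (rule mult_le_one[OF gauss_kernel_const_le_1]) auto

lemma gauss_kernel_minus: "gauss_kernel (- x) = gauss_kernel x"
  by (simp add: gauss_kernel_def)

lemma gauss_kernel_measurable [measurable]: "gauss_kernel \<in> borel_measurable borel"
  unfolding gauss_kernel_def[abs_def] by measurable

text \<open>The derivative -t exp(-t^2/2) has modulus at most 1, because \<bar>t\<bar> \<le> 1 +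
  t^2/2 \<le> exp(t^2/2).\<close>

lemma exp_half_square_lipschitz:
  fixes a b :: real
  shows "\<bar>exp (- a\<^sup>2 / 2) - exp (- b\<^sup>2 / 2)\<bar> \<le> \<bar>a - b\<bar>"
proof -
  have deriv: "((\<lambda>t. exp (- t\<^sup>2 / 2)) has_real_derivative (- t * exp (- t\<^sup>2 / 2))) (at t within UNIV)" for t :: real
    by (auto intro!: derivative_eq_intros)
  have bound: "norm (- t * exp (- t\<^sup>2 / 2)) \<le> 1" for t :: real
  proof -
    have "\<bar>t\<bar> \<le> 1 + t\<^sup>2 / 2"
      using zero_le_power2[of "\<bar>t\<bar> - 1"] by (simp add: power2_eq_square algebra_simps)
    also have "\<dots> \<le> exp (t\<^sup>2 / 2)"
      using exp_ge_add_one_self[of "t\<^sup>2 / 2"] by simp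
    finally have "\<bar>t\<bar> * exp (- (t\<^sup>2 / 2)) \<le> exp (t\<^sup>2 / 2) * exp (- (t\<^sup>2 / 2))"
      by (intro mult_right_mono) auto
    then show ?thesis by (simp add: abs_mult exp_add[symmetric])
  qed
  have "norm (exp (- a\<^sup>2 / 2) - exp (- b\<^sup>2 / 2)) \<le> 1 * norm (a - b)"
    by (rule field_differentiable_bound[OF convex_UNIV deriv bound]) auto
  then show ?thesis by simp
qed

text \<open>The kernel is radial with normalising constant at most 1, so the one-dimensional bound
  and the reverse triangle inequality suffice. This is what carries concentration from a grid to all
  points.\<close>

lemma gauss_kernel_lipschitz: "\<bar>gauss_kernel x - gauss_kernel (y :: real ^ 'd)\<bar> \<le> norm (x - y)"
proof -
  let ?c = "(2 * pi) powr (- real CARD('d) / 2)"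
  have "\<bar>gauss_kernel x - gauss_kernel y\<bar> = ?c * \<bar>exp (- (norm x)\<^sup>2 / 2) - exp (- (norm y)\<^sup>2 / 2)\<bar>"
    by (simp add: gauss_kernel_def abs_mult flip: right_diff_distrib)
  also have "\<dots> \<le> 1 * \<bar>norm x - norm y\<bar>"
    by (intro mult_mono exp_half_square_lipschitz gauss_kernel_const_le_1) auto
  also have "\<dots> \<le> norm (x - y)" using norm_triangle_ineq3[of x y] by simp
  finally show ?thesis .
qed

text \<open>The kernel is a product of one-dimensional standard normal densities in the coordinates,
  and the integral factorises accordingly.\<close>

lemma nn_integral_gauss_kernel: "(\<integral>\<^sup>+x. ennreal (gauss_kernel (x :: real ^ 'd)) \<partial>lborel) = 1"
proof -
  have prod: "gauss_kernel x = (\<Prod>b\<in>Basis. std_normal_density (x \<bullet> b))" for x :: "real ^ 'd"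
  proof -
    have "(\<Prod>b\<in>Basis. std_normal_density (x \<bullet> b))
        = (1 / sqrt (2 * pi)) ^ CARD('d) * exp (\<Sum>b\<in>Basis. - (x \<bullet> b)\<^sup>2 / 2)"
      by (simp add: std_normal_density_def prod.distrib exp_sum power_divide prod_dividef)
    also have "(1 / sqrt (2 * pi)) ^ CARD('d) = (2 * pi) powr (- real CARD('d) / 2)"
    proof -
      have "1 / sqrt (2 * pi) = (2 * pi) powr (- 1 / 2)"
        by (simp add: powr_half_sqrt[symmetric] powr_minus_divide)
      then have "(1 / sqrt (2 * pi)) ^ CARD('d) = ((2 * pi) powr (- 1 / 2)) powr real CARD('d)"
        by (simp add: powr_realpow)
      then show ?thesis by (simp add: powr_powr)
    qed
    also have "(\<Sum>b\<in>Basis. - (x \<bullet> b)\<^sup>2 / 2) = - (norm x)\<^sup>2 / 2"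
    proof -
      have "(norm x)\<^sup>2 = (\<Sum>b\<in>Basis. (x \<bullet> b)\<^sup>2)"
        using euclidean_inner[of x x] unfolding power2_norm_eq_inner by (simp add: power2_eq_square)
      then show ?thesis by (simp add: sum_negf sum_divide_distrib)
    qed
    finally show ?thesis by (simp add: gauss_kernel_def)
  qed
  have "(\<integral>\<^sup>+x. ennreal (gauss_kernel (x :: real ^ 'd)) \<partial>lborel)
      = (\<integral>\<^sup>+x. (\<Prod>b\<in>Basis. ennreal (std_normal_density ((x :: real ^ 'd) \<bullet> b))) \<partial>lborel)"
    by (simp add: prod prod_ennreal)
  also have "\<dots> = (\<Prod>b\<in>(Basis :: (real ^ 'd) set). (\<integral>\<^sup>+x. ennreal (std_normal_density x) \<partial>lborel))"
    by (rule nn_integral_lborel_prod) auto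
  also have "(\<integral>\<^sup>+x. ennreal (std_normal_density x) \<partial>lborel) = 1"
  proof -
    interpret prob_space "density lborel std_normal_density"
      by (rule prob_space_normal_density) simp
    show ?thesis using emeasure_space_1 by (simp add: emeasure_density)
  qed
  finally show ?thesis by simp
qed

lemma
  shows integrable_gauss_kernel: "integrable lborel (gauss_kernel :: real ^ 'd \<Rightarrow> real)"
    and integral_gauss_kernel: "integral\<^sup>L lborel (gauss_kernel :: real ^ 'd \<Rightarrow> real) = 1"
proof -
  have "has_bochner_integral lborel (gauss_kernel :: real ^ 'd \<Rightarrow> real) 1"
    using nn_integral_gauss_kernel
    by (intro has_bochner_integral_nn_integral) (auto simp: gauss_kernel_pos less_imp_le)
  then show "integrable lborel (gauss_kernel :: real ^ 'd \<Rightarrow> real)"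
    and "integral\<^sup>L lborel (gauss_kernel :: real ^ 'd \<Rightarrow> real) = 1"
    by (auto simp: has_bochner_integral_iff)
qed

section \<open>Scaling the kernel by the bandwidth\<close>

lemma scaled_kernel_pos: "0 < h \<Longrightarrow> 0 < scaled_kernel h x"
  by (simp add: scaled_kernel_def gauss_kernel_pos)

lemma scaled_kernel_nonneg [simp]: "0 < h \<Longrightarrow> 0 \<le> scaled_kernel h x"
  by (simp add: scaled_kernel_def)

lemma abs_scaled_kernel [simp]: "0 < h \<Longrightarrow> \<bar>scaled_kernel h x\<bar> = scaled_kernel h x"
  by simp

lemma scaled_kernel_le: "0 < h \<Longrightarrow> scaled_kernel h (x :: real ^ 'd) \<le> 1 / h ^ CARD('d)"
  by (simp add: scaled_kernel_def gauss_kernel_le_1 divide_right_mono)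

lemma scaled_kernel_minus_commute: "scaled_kernel h (x - y) = scaled_kernel h (y - x)"
  using gauss_kernel_minus[of "(x - y) /\<^sub>R h"]
  by (simp add: scaled_kernel_def flip: scaleR_minus_right)

lemma scaled_kernel_lipschitz:
  assumes "0 < h"
  shows "\<bar>scaled_kernel h x - scaled_kernel h (y :: real ^ 'd)\<bar> \<le> norm (x - y) / h ^ (CARD('d) + 1)"
proof -
  have "\<bar>scaled_kernel h x - scaled_kernel h y\<bar>
      = \<bar>gauss_kernel (x /\<^sub>R h) - gauss_kernel (y /\<^sub>R h)\<bar> / h ^ CARD('d)"
    using assms by (simp add: scaled_kernel_def flip: diff_divide_distrib)
  also have "\<dots> \<le> norm (x /\<^sub>R h - y /\<^sub>R h) / h ^ CARD('d)"
    using assms by (intro divide_right_mono gauss_kernel_lipschitz) auto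
  also have "\<dots> = norm (x - y) / h ^ (CARD('d) + 1)"
  proof -
    have "x /\<^sub>R h - y /\<^sub>R h = (x - y) /\<^sub>R h" by (simp add: scaleR_diff_right)
    then show ?thesis using assms by (simp add: divide_inverse)
  qed
  finally show ?thesis .
qed

text \<open>The substitution y = x - h z, whose Jacobian h^d cancels the normalisation. It exhibits
  smoothing as an average of translates of \<open>r\<close>, the form to which continuity of
  translations applies.\<close>

lemma integral_scaled_kernel_eq:
  fixes r :: "real ^ 'd \<Rightarrow> real"
  assumes h: "0 < h" and [measurable]: "r \<in> borel_measurable borel"
  shows "(\<integral>y. scaled_kernel h (x - y) * r y \<partial>lborel) = (\<integral>z. gauss_kernel z * r (x - h *\<^sub>R z) \<partial>lborel)"
proof -
  have "- h \<noteq> 0" using h by simp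
  from lborel_affine[OF this, of x]
  have aff: "(lborel :: (real ^ 'd) measure)
      = density (distr lborel borel (\<lambda>z. x + (- h) *\<^sub>R z)) (\<lambda>_. ennreal (\<bar>- h\<bar> ^ CARD('d)))"
    unfolding DIM_cart DIM_real mult_1_right .
  show ?thesis
    using h by (subst aff) (auto simp: integral_density integral_distr scaled_kernel_def)
qed

lemma integral_scaled_kernel: "0 < h \<Longrightarrow> (\<integral>y. scaled_kernel h (x - y) \<partial>lborel) = 1"
  using integral_scaled_kernel_eq[of h "\<lambda>_. 1" x] integral_gauss_kernel by simp

section \<open>Continuity of translations in \<open>L\<^sup>1\<close>\<close>

text \<open>Fubini together with the triangle inequality, that is, Minkowski's integral inequality
  in L^1. The first coordinate is the one averaged over. Both L^1 estimates for smoothing rest on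
  it.\<close>

lemma
  fixes F :: "'a::euclidean_space \<times> 'b::euclidean_space \<Rightarrow> real"
  assumes F[measurable]: "F \<in> borel_measurable (lborel \<Otimes>\<^sub>M lborel)"
    and int1: "integrable lborel (\<lambda>z. \<integral>x. \<bar>F (z, x)\<bar> \<partial>lborel)"
    and int2: "\<And>z. integrable lborel (\<lambda>x. F (z, x))"
  shows integrable_partial_integral: "integrable lborel (\<lambda>x. \<integral>z. F (z, x) \<partial>lborel)"
    and AE_integrable_partial: "AE x in lborel. integrable lborel (\<lambda>z. F (z, x))"
    and abs_partial_integral_le:
      "(\<integral>x. \<bar>\<integral>z. F (z, x) \<partial>lborel\<bar> \<partial>lborel) \<le> (\<integral>z. (\<integral>x. \<bar>F (z, x)\<bar> \<partial>lborel) \<partial>lborel)"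
proof -
  have F_int: "integrable (lborel \<Otimes>\<^sub>M lborel) F"
    using int1 int2 by (intro lborel_pair.Fubini_integrable F) auto
  then have F_int': "integrable (lborel \<Otimes>\<^sub>M lborel) (\<lambda>(z, x). F (z, x))" by simp
  have aF: "integrable (lborel \<Otimes>\<^sub>M lborel) (\<lambda>(z, x). \<bar>F (z, x)\<bar>)"
    using integrable_abs[OF F_int] by (simp add: split_beta')
  show *: "integrable lborel (\<lambda>x. \<integral>z. F (z, x) \<partial>lborel)"
    using lborel_pair.integrable_snd[OF F_int'] by simp
  show "AE x in lborel. integrable lborel (\<lambda>z. F (z, x))"
    using lborel_pair.AE_integrable_snd[OF F_int'] by simp
  have "(\<integral>x. \<bar>\<integral>z. F (z, x) \<partial>lborel\<bar> \<partial>lborel) \<le> (\<integral>x. (\<integral>z. \<bar>F (z, x)\<bar> \<partial>lborel) \<partial>lborel)"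
    using lborel_pair.integrable_snd[OF aF] *
    by (intro integral_mono) auto
  also have "\<dots> = (\<integral>z. (\<integral>x. \<bar>F (z, x)\<bar> \<partial>lborel) \<partial>lborel)"
    using lborel_pair.Fubini_integral[OF aF] by simp
  finally show "(\<integral>x. \<bar>\<integral>z. F (z, x) \<partial>lborel\<bar> \<partial>lborel) \<le> (\<integral>z. (\<integral>x. \<bar>F (z, x)\<bar> \<partial>lborel) \<partial>lborel)" .
qed

lemma
  fixes r :: "'a::euclidean_space \<Rightarrow> real"
  assumes r: "r \<in> borel_measurable borel"
  shows integral_lborel_shift: "(\<integral>x. r (x - t) \<partial>lborel) = (\<integral>x. r x \<partial>lborel)"
    and integrable_lborel_shift_iff: "integrable lborel (\<lambda>x. r (x - t)) \<longleftrightarrow> integrable lborel r"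
proof -
  have m: "(+) (- t) \<in> measurable lborel borel" by measurable
  show "(\<integral>x. r (x - t) \<partial>lborel) = (\<integral>x. r x \<partial>lborel)"
    using integral_distr[OF m r] unfolding lborel_distr_plus by (simp add: algebra_simps)
  show "integrable lborel (\<lambda>x. r (x - t)) \<longleftrightarrow> integrable lborel r"
    using integrable_distr_eq[OF m r] unfolding lborel_distr_plus by (simp add: algebra_simps)
qed

text \<open>Inserting \<open>s\<close> at x - t and at x produces two errors of equal L^1 norm, by
  translation invariance. The case s = 0 bounds the translation error by twice the norm of
  \<open>r\<close>, uniformly in \<open>t\<close>.\<close>

lemma translation_L1_le:
  fixes r s :: "'a::euclidean_space \<Rightarrow> real"
  assumes r: "integrable lborel r" and s: "integrable lborel s"
  shows "(\<integral>x. \<bar>r (x - t) - r x\<bar> \<partial>lborel)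
    \<le> 2 * (\<integral>x. \<bar>r x - s x\<bar> \<partial>lborel) + (\<integral>x. \<bar>s (x - t) - s x\<bar> \<partial>lborel)"
proof -
  have [measurable]: "r \<in> borel_measurable borel" "s \<in> borel_measurable borel"
    using r s by auto
  have [simp]: "integrable lborel (\<lambda>x. r (x - t))" "integrable lborel (\<lambda>x. s (x - t))"
    using r s by (simp_all add: integrable_lborel_shift_iff)
  have "(\<integral>x. \<bar>r (x - t) - r x\<bar> \<partial>lborel)
      \<le> (\<integral>x. \<bar>r (x - t) - s (x - t)\<bar> + \<bar>r x - s x\<bar> + \<bar>s (x - t) - s x\<bar> \<partial>lborel)"
    using r s by (intro integral_mono) auto
  also have "\<dots> = (\<integral>x. \<bar>r (x - t) - s (x - t)\<bar> \<partial>lborel) + (\<integral>x. \<bar>r x - s x\<bar> \<partial>lborel)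
      + (\<integral>x. \<bar>s (x - t) - s x\<bar> \<partial>lborel)"
    using r s by simp
  also have "(\<integral>x. \<bar>r (x - t) - s (x - t)\<bar> \<partial>lborel) = (\<integral>x. \<bar>r x - s x\<bar> \<partial>lborel)"
    by (rule integral_lborel_shift[of "\<lambda>x. \<bar>r x - s x\<bar>"]) measurable
  finally show ?thesis by simp
qed

text \<open>The functions whose translates converge in L^1 form a closed set, since an approximation
  error enters at most twice. This permits an argument by density.\<close>

lemma translation_L1_approx:
  fixes r :: "'a::euclidean_space \<Rightarrow> real"
  assumes r: "integrable lborel r"
    and approx: "\<And>e. 0 < e \<Longrightarrow> \<exists>s. integrable lborel s \<and> (\<integral>x. \<bar>r x - s x\<bar> \<partial>lborel) \<le> e \<and>
      (\<lambda>n. \<integral>x. \<bar>s (x - t n) - s x\<bar> \<partial>lborel) \<longlonglongrightarrow> 0"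
  shows "(\<lambda>n. \<integral>x. \<bar>r (x - t n) - r x\<bar> \<partial>lborel) \<longlonglongrightarrow> 0"
proof (rule LIMSEQ_I)
  fix e :: real assume "0 < e"
  then obtain s where s: "integrable lborel s" "(\<integral>x. \<bar>r x - s x\<bar> \<partial>lborel) \<le> e / 4"
    and lim: "(\<lambda>n. \<integral>x. \<bar>s (x - t n) - s x\<bar> \<partial>lborel) \<longlonglongrightarrow> 0"
    using approx[of "e / 4"] by auto
  obtain N where N: "\<And>n. n \<ge> N \<Longrightarrow> norm ((\<integral>x. \<bar>s (x - t n) - s x\<bar> \<partial>lborel) - 0) < e / 2"
    using LIMSEQ_D[OF lim, of "e / 2"] \<open>0 < e\<close> by auto
  have "norm ((\<integral>x. \<bar>r (x - t n) - r x\<bar> \<partial>lborel) - 0) < e" if "n \<ge> N" for n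
  proof -
    have "0 \<le> (\<integral>x. \<bar>r (x - t n) - r x\<bar> \<partial>lborel)" by (rule integral_nonneg_AE) auto
    then show ?thesis
      using translation_L1_le[OF r s(1), of "t n"] s(2) N[OF that] by simp
  qed
  then show "\<exists>N. \<forall>n\<ge>N. norm ((\<integral>x. \<bar>r (x - t n) - r x\<bar> \<partial>lborel) - 0) < e" by blast
qed

text \<open>For indicators the absolute difference is the sum minus twice the product. The product
  vanishes off \<open>U\<close> and tends to 1 at each point of \<open>U\<close> by openness, so
  dominated convergence applies without any condition on the boundary.\<close>

lemma translation_L1_open:
  fixes U :: "'a::euclidean_space set"
  assumes U: "open U" "emeasure lborel U < \<infinity>" and t: "t \<longlonglongrightarrow> 0"
  shows "(\<lambda>n. \<integral>x. \<bar>indicator U (x - t n) - indicator U x\<bar> \<partial>lborel) \<longlonglongrightarrow> (0 :: real)"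
proof -
  let ?i = "indicator U :: 'a \<Rightarrow> real"
  have [measurable]: "U \<in> sets borel" using U by auto
  have int: "integrable lborel ?i" using U by (simp add: integrable_indicator_iff)
  have int': "integrable lborel (\<lambda>x. ?i (x - s))" for s
    by (subst integrable_lborel_shift_iff) (auto simp: int)
  have prod_int: "integrable lborel (\<lambda>x. ?i x * ?i (x - s))" for s
    by (rule Bochner_Integration.integrable_bound[OF int]) (auto split: split_indicator)
  have "(\<lambda>n. \<integral>x. ?i x * ?i (x - t n) \<partial>lborel) \<longlonglongrightarrow> (\<integral>x. ?i x \<partial>lborel)"
  proof (rule integral_dominated_convergence[where w = ?i])
    have "(\<lambda>n. ?i x * ?i (x - t n)) \<longlonglongrightarrow> ?i x" for x
    proof (cases "x \<in> U")
      case True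
      have "(\<lambda>n. x - t n) \<longlonglongrightarrow> x - 0" by (intro tendsto_intros t)
      then have "\<forall>\<^sub>F n in sequentially. x - t n \<in> U"
        using topological_tendstoD[OF _ U(1), of "\<lambda>n. x - t n" x] True by simp
      then have "\<forall>\<^sub>F n in sequentially. ?i x * ?i (x - t n) = ?i x"
        by eventually_elim (simp add: True)
      then show ?thesis by (rule tendsto_eventually)
    qed auto
    then show "AE x in lborel. (\<lambda>n. ?i x * ?i (x - t n)) \<longlonglongrightarrow> ?i x" by simp
  qed (auto simp: int split: split_indicator)
  then have "(\<lambda>n. 2 * (\<integral>x. ?i x \<partial>lborel) - 2 * (\<integral>x. ?i x * ?i (x - t n) \<partial>lborel))
      \<longlonglongrightarrow> 2 * (\<integral>x. ?i x \<partial>lborel) - 2 * (\<integral>x. ?i x \<partial>lborel)"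
    by (intro tendsto_intros)
  moreover have "(\<integral>x. \<bar>?i (x - s) - ?i x\<bar> \<partial>lborel)
      = 2 * (\<integral>x. ?i x \<partial>lborel) - 2 * (\<integral>x. ?i x * ?i (x - s) \<partial>lborel)" for s
  proof -
    have "(\<integral>x. \<bar>?i (x - s) - ?i x\<bar> \<partial>lborel)
        = (\<integral>x. ?i (x - s) + ?i x - 2 * (?i x * ?i (x - s)) \<partial>lborel)"
      by (intro Bochner_Integration.integral_cong) (auto split: split_indicator)
    also have "\<dots> = (\<integral>x. ?i (x - s) \<partial>lborel) + (\<integral>x. ?i x \<partial>lborel)
        - 2 * (\<integral>x. ?i x * ?i (x - s) \<partial>lborel)"
      using int int' prod_int by simp
    also have "(\<integral>x. ?i (x - s) \<partial>lborel) = (\<integral>x. ?i x \<partial>lborel)"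
      by (rule integral_lborel_shift) measurable
    finally show ?thesis by simp
  qed
  ultimately show ?thesis by simp
qed

lemma translation_L1:
  fixes r :: "'a::euclidean_space \<Rightarrow> real"
  assumes r: "integrable lborel r" and t: "t \<longlonglongrightarrow> 0"
  shows "(\<lambda>n. \<integral>x. \<bar>r (x - t n) - r x\<bar> \<partial>lborel) \<longlonglongrightarrow> 0"
  using r
proof (induction rule: integrable_induct)
  case (base A c)
  have [measurable]: "A \<in> sets borel" using base by simp
  have *: "(\<lambda>n. \<integral>x. \<bar>indicator A (x - t n) - indicator A x\<bar> \<partial>lborel) \<longlonglongrightarrow> (0 :: real)"
  proof (rule translation_L1_approx)
    show "integrable lborel (indicator A :: 'a \<Rightarrow> real)"
      using base by (simp add: integrable_indicator_iff)
    fix e :: real assume e: "0 < e"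
    \<comment> \<open>Outer regularity replaces a measurable set of finite measure by an open one at
      small L^1 cost.\<close>
    obtain U where U: "open U" "A \<subseteq> U" "emeasure lborel (U - A) < ennreal e"
      using outer_regular_lborel[of A e] e by auto
    have [measurable]: "U \<in> sets borel" using U by auto
    have fin: "emeasure lborel U < \<infinity>"
    proof -
      have "emeasure lborel U \<le> emeasure lborel A + emeasure lborel (U - A)"
        using U(2) emeasure_subadditive[of A lborel "U - A"] by (simp add: Un_absorb1)
      also have "\<dots> < \<infinity>"
        using base order.strict_trans[OF U(3) ennreal_less_top] by simp
      finally show ?thesis .
    qed
    have "(\<integral>x. \<bar>indicator A x - indicator U x\<bar> \<partial>lborel) = (\<integral>x. (indicator (U - A) x :: real) \<partial>lborel)"
      using U(2) by (intro Bochner_Integration.integral_cong) (auto split: split_indicator)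
    also have "\<dots> = measure lborel (U - A)" by simp
    also have "\<dots> \<le> e" using U(3) e
      by (simp add: measure_def enn2real_leI)
    finally show "\<exists>s. integrable lborel s \<and> (\<integral>x. \<bar>indicator A x - s x\<bar> \<partial>lborel) \<le> e \<and>
        (\<lambda>n. \<integral>x. \<bar>s (x - t n) - s x\<bar> \<partial>lborel) \<longlonglongrightarrow> 0"
      using translation_L1_open[OF U(1) fin t] fin
      by (intro exI[of _ "indicator U"]) (simp add: integrable_indicator_iff)
  qed
  have "\<bar>indicator A (x - s) *\<^sub>R c - indicator A x *\<^sub>R c\<bar>
      = \<bar>c\<bar> * \<bar>indicator A (x - s) - indicator A x\<bar>" for x s
    by (auto split: split_indicator)
  then show ?case using tendsto_mult_left[OF *, of "\<bar>c\<bar>"] by simp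
next
  case (add f g)
  have [measurable]: "f \<in> borel_measurable borel" "g \<in> borel_measurable borel"
    using add by auto
  have [simp]: "integrable lborel (\<lambda>x. f (x - s))" "integrable lborel (\<lambda>x. g (x - s))" for s
    using add by (simp_all add: integrable_lborel_shift_iff)
  show ?case
  proof (rule tendsto_sandwich[OF _ _ tendsto_const tendsto_add_zero[OF add.IH]])
    show "\<forall>\<^sub>F n in sequentially. 0 \<le> (\<integral>x. \<bar>f (x - t n) + g (x - t n) - (f x + g x)\<bar> \<partial>lborel)"
      by simp
    have "(\<integral>x. \<bar>f (x - s) + g (x - s) - (f x + g x)\<bar> \<partial>lborel)
        \<le> (\<integral>x. \<bar>f (x - s) - f x\<bar> + \<bar>g (x - s) - g x\<bar> \<partial>lborel)" for s
      using add by (intro integral_mono) auto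
    then show "\<forall>\<^sub>F n in sequentially. (\<integral>x. \<bar>f (x - t n) + g (x - t n) - (f x + g x)\<bar> \<partial>lborel)
        \<le> (\<integral>x. \<bar>f (x - t n) - f x\<bar> \<partial>lborel) + (\<integral>x. \<bar>g (x - t n) - g x\<bar> \<partial>lborel)"
      using add by simp
  qed
next
  case (lim f s)
  show ?case
  proof (rule translation_L1_approx[OF lim.hyps(4)])
    fix e :: real assume "0 < e"
    have [measurable]: "f \<in> borel_measurable lborel" "\<And>i. s i \<in> borel_measurable lborel"
      using lim by auto
    \<comment> \<open>The approximants satisfy \<bar>s i x\<bar> \<le> 2 \<bar>f x\<bar>, whence the
      dominating function 3 \<bar>f\<bar>.\<close>
    have "(\<lambda>i. \<integral>x. \<bar>f x - s i x\<bar> \<partial>lborel) \<longlonglongrightarrow> (\<integral>x. 0 \<partial>(lborel :: 'a measure))"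
    proof (rule integral_dominated_convergence[where w = "\<lambda>x. 3 * \<bar>f x\<bar>"])
      have "(\<lambda>i. \<bar>f x - s i x\<bar>) \<longlonglongrightarrow> \<bar>f x - f x\<bar>" for x
        using lim.hyps(2)[of x] by (intro tendsto_intros) auto
      then show "AE x in lborel. (\<lambda>i. \<bar>f x - s i x\<bar>) \<longlonglongrightarrow> 0" by simp
      have "norm \<bar>f x - s i x\<bar> \<le> 3 * \<bar>f x\<bar>" for i x
        using lim.hyps(3)[of x i] by simp
      then show "AE x in lborel. norm \<bar>f x - s i x\<bar> \<le> 3 * \<bar>f x\<bar>" for i by simp
    qed (use lim in auto)
    then obtain i where "norm ((\<integral>x. \<bar>f x - s i x\<bar> \<partial>lborel) - 0) < e"
      using LIMSEQ_D[of _ 0 e] \<open>0 < e\<close> by fastforce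
    then show "\<exists>s. integrable lborel s \<and> (\<integral>x. \<bar>f x - s x\<bar> \<partial>lborel) \<le> e \<and>
        (\<lambda>n. \<integral>x. \<bar>s (x - t n) - s x\<bar> \<partial>lborel) \<longlonglongrightarrow> 0"
      using lim.hyps(1) lim.IH by (intro exI[of _ "s i"]) auto
  qed
qed

section \<open>Gaussian smoothing in \<open>L\<^sup>1\<close>\<close>

text \<open>The convolution of \<open>r\<close> with the scaled kernel. For a density it is the mean
  of the kernel estimate.\<close>

definition smooth :: "real \<Rightarrow> (real ^ 'd \<Rightarrow> real) \<Rightarrow> real ^ 'd \<Rightarrow> real" where
  "smooth h r x = (\<integral>y. scaled_kernel h (x - y) * r y \<partial>lborel)"

lemma scaled_kernel_measurable_comp [measurable]:
  "f \<in> borel_measurable M \<Longrightarrow> (\<lambda>x. scaled_kernel h (f x)) \<in> borel_measurable M"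
  by (rule measurable_compose[OF _ scaled_kernel_measurable])

lemma smooth_measurable [measurable]:
  assumes [measurable]: "r \<in> borel_measurable borel"
  shows "smooth h r \<in> borel_measurable borel"
proof -
  have "(\<lambda>(x, y). scaled_kernel h (x - y) * r y) \<in> borel_measurable (borel \<Otimes>\<^sub>M lborel)"
    by measurable
  then have "(\<lambda>x. \<integral>y. scaled_kernel h (x - y) * r y \<partial>lborel) \<in> borel_measurable borel"
    by (rule lborel.borel_measurable_lebesgue_integral)
  then show ?thesis by (simp add: smooth_def[abs_def])
qed

lemma integrable_scaled_kernel_mult:
  fixes r :: "real ^ 'd \<Rightarrow> real"
  assumes "0 < h" "integrable lborel r"
  shows "integrable lborel (\<lambda>y. scaled_kernel h (x - y) * r y)"
proof (rule Bochner_Integration.integrable_bound)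
  show "integrable lborel (\<lambda>y. 1 / h ^ CARD('d) * r y)" using assms by simp
  show "(\<lambda>y. scaled_kernel h (x - y) * r y) \<in> borel_measurable lborel"
    using assms(2) by (auto dest: borel_measurable_integrable)
  have "scaled_kernel h (x - y) * \<bar>r y\<bar> \<le> 1 / h ^ CARD('d) * \<bar>r y\<bar>" for y
    by (rule mult_right_mono[OF scaled_kernel_le[OF assms(1)]]) simp
  then show "AE y in lborel. norm (scaled_kernel h (x - y) * r y) \<le> norm (1 / h ^ CARD('d) * r y)"
    using assms(1) by (auto simp: abs_mult)
qed

text \<open>The Bochner integral of a non-integrable function is 0, whereas this one is 1.\<close>

lemma integrable_scaled_kernel:
  assumes "0 < h"
  shows "integrable lborel (\<lambda>y. scaled_kernel h (x - y))"
  using integral_scaled_kernel[OF assms, of x] not_integrable_integral_eq by fastforce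

lemma smooth_diff:
  assumes "0 < h" "integrable lborel r" "integrable lborel s"
  shows "smooth h (\<lambda>x. r x - s x) x = smooth h r x - smooth h s x"
  using assms by (simp add: smooth_def integrable_scaled_kernel_mult right_diff_distrib)

lemma smooth_nonneg:
  assumes "0 < h" "\<And>x. 0 \<le> r x"
  shows "0 \<le> smooth h r x"
  unfolding smooth_def
  by (intro integral_nonneg_AE AE_I2 mult_nonneg_nonneg less_imp_le[OF scaled_kernel_pos] assms)

lemma smooth_abs_le:
  assumes "0 < h" "integrable lborel r" "\<And>x. \<bar>r x\<bar> \<le> R"
  shows "\<bar>smooth h r x\<bar> \<le> R"
proof -
  have "\<bar>smooth h r x\<bar> \<le> (\<integral>y. \<bar>scaled_kernel h (x - y) * r y\<bar> \<partial>lborel)"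
    unfolding smooth_def by (rule integral_abs_bound)
  also have "\<dots> \<le> (\<integral>y. scaled_kernel h (x - y) * R \<partial>lborel)"
  proof (rule integral_mono)
    show "integrable lborel (\<lambda>y. scaled_kernel h (x - y) * R)"
      by (intro integrable_mult_left integrable_scaled_kernel assms)
    show "\<bar>scaled_kernel h (x - y) * r y\<bar> \<le> scaled_kernel h (x - y) * R" for y
      using assms scaled_kernel_pos[OF assms(1), of "x - y"]
      by (simp add: abs_mult)
  qed (intro integrable_abs integrable_scaled_kernel_mult assms)
  also have "\<dots> = R"
    using integral_scaled_kernel[OF assms(1), of x] by simp
  finally show ?thesis .
qed

text \<open>Integrating over x first, where the kernel has mass one, shows that smoothing contracts
  the L^1 norm.\<close>

lemma
  fixes r :: "real ^ 'd \<Rightarrow> real"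
  assumes h: "0 < h" and r: "integrable lborel r"
  shows integrable_smooth: "integrable lborel (smooth h r)"
    and smooth_L1_le: "(\<integral>x. \<bar>smooth h r x\<bar> \<partial>lborel) \<le> (\<integral>x. \<bar>r x\<bar> \<partial>lborel)"
proof -
  define F where "F = (\<lambda>(y, x). scaled_kernel h (x - y) * r y)"
  have [measurable]: "r \<in> borel_measurable borel" using r by auto
  have kint: "has_bochner_integral lborel (\<lambda>x. scaled_kernel h (x - y)) 1" for y :: "real ^ 'd"
    using integrable_scaled_kernel[OF h, of y] integral_scaled_kernel[OF h, of y]
    by (simp add: has_bochner_integral_iff scaled_kernel_minus_commute[of h _ y])
  have F: "F \<in> borel_measurable (lborel \<Otimes>\<^sub>M lborel)"
    unfolding F_def by measurable
  have F_abs: "(\<integral>x. \<bar>F (y, x)\<bar> \<partial>lborel) = \<bar>r y\<bar>" for y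
    using kint[of y] h by (simp add: F_def abs_mult has_bochner_integral_iff)
  have int1: "integrable lborel (\<lambda>y. \<integral>x. \<bar>F (y, x)\<bar> \<partial>lborel)"
    unfolding F_abs using r by simp
  have int2: "integrable lborel (\<lambda>x. F (y, x))" for y
    using kint[of y] by (simp add: F_def has_bochner_integral_iff)
  have eq: "(\<integral>y. F (y, x) \<partial>lborel) = smooth h r x" for x
    by (simp add: F_def smooth_def)
  show "integrable lborel (smooth h r)"
    using integrable_partial_integral[OF F int1 int2] unfolding eq .
  show "(\<integral>x. \<bar>smooth h r x\<bar> \<partial>lborel) \<le> (\<integral>x. \<bar>r x\<bar> \<partial>lborel)"
    using abs_partial_integral_le[OF F int1 int2] unfolding eq F_abs .
qed

text \<open>The L^1 error is at most the Gaussian average of the translation errors \<tau>(h z).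
  These vanish as h tends to 0 and are bounded by twice the norm of \<open>r\<close>, so dominated
  convergence applies to every integrable \<open>r\<close>, whatever its behaviour at the boundary
  of its support.\<close>

lemma smooth_L1_tendsto:
  fixes r :: "real ^ 'd \<Rightarrow> real"
  assumes h: "\<forall>\<^sub>F n in sequentially. 0 < h n" "h \<longlonglongrightarrow> 0" and r: "integrable lborel r"
  shows "(\<lambda>n. \<integral>x. \<bar>smooth (h n) r x - r x\<bar> \<partial>lborel) \<longlonglongrightarrow> 0"
proof -
  have [measurable]: "r \<in> borel_measurable borel" using r by auto
  define \<tau> where "\<tau> = (\<lambda>t. \<integral>x. \<bar>r (x - t) - r x\<bar> \<partial>lborel)"
  have \<tau>_meas [measurable]: "\<tau> \<in> borel_measurable borel"
  proof -
    have "(\<lambda>(t, x). \<bar>r (x - t) - r x\<bar>) \<in> borel_measurable (borel \<Otimes>\<^sub>M lborel)"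
      by measurable
    then show ?thesis unfolding \<tau>_def by (rule lborel.borel_measurable_lebesgue_integral)
  qed
  have \<tau>_le: "\<tau> t \<le> 2 * (\<integral>x. \<bar>r x\<bar> \<partial>lborel)" and \<tau>_nonneg: "0 \<le> \<tau> t" for t
    using translation_L1_le[OF r, of "\<lambda>_. 0" t] by (simp_all add: \<tau>_def)
  have bound: "(\<integral>x. \<bar>smooth k r x - r x\<bar> \<partial>lborel) \<le> (\<integral>z. gauss_kernel z * \<tau> (k *\<^sub>R z) \<partial>lborel)"
    if k: "0 < k" for k
  proof -
    \<comment> \<open>Unit mass of the kernel turns smooth k r x - r x into the z-integral of
      \<open>F\<close>.\<close>
    define F where "F = (\<lambda>(z, x). gauss_kernel z * (r (x - k *\<^sub>R z) - r x))"
    have F: "F \<in> borel_measurable (lborel \<Otimes>\<^sub>M lborel)"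
      unfolding F_def by measurable
    have F_abs: "(\<integral>x. \<bar>F (z, x)\<bar> \<partial>lborel) = gauss_kernel z * \<tau> (k *\<^sub>R z)" for z
      using gauss_kernel_pos[of z] by (simp add: F_def abs_mult less_imp_le \<tau>_def)
    have int1: "integrable lborel (\<lambda>z. \<integral>x. \<bar>F (z, x)\<bar> \<partial>lborel)"
      unfolding F_abs
    proof (rule Bochner_Integration.integrable_bound)
      show "integrable lborel (\<lambda>z :: real ^ 'd. gauss_kernel z * (2 * (\<integral>x. \<bar>r x\<bar> \<partial>lborel)))"
        by (intro integrable_mult_left integrable_gauss_kernel)
      show "AE z in lborel. norm (gauss_kernel z * \<tau> (k *\<^sub>R z))
          \<le> norm (gauss_kernel z * (2 * (\<integral>x. \<bar>r x\<bar> \<partial>lborel)))"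
        using \<tau>_le \<tau>_nonneg
        by (auto simp: abs_mult less_imp_le intro!: AE_I2 mult_left_mono)
    qed measurable
    have int2: "integrable lborel (\<lambda>x. F (z, x))" for z
      using r by (simp add: F_def integrable_lborel_shift_iff)
    have eq: "AE x in lborel. (\<integral>z. F (z, x) \<partial>lborel) = smooth k r x - r x"
      using AE_integrable_partial[OF F int1 int2]
    proof eventually_elim
      case (elim x)
      have *: "(\<lambda>z. gauss_kernel z * r (x - k *\<^sub>R z)) = (\<lambda>z. F (z, x) + gauss_kernel z * r x)"
        by (auto simp: F_def right_diff_distrib)
      show ?case
        unfolding smooth_def integral_scaled_kernel_eq[OF k \<open>r \<in> borel_measurable borel\<close>] *
        using Bochner_Integration.integral_add[OF elim integrable_mult_left[OF integrable_gauss_kernel, of "r x"]]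
        by (simp add: integral_gauss_kernel)
    qed
    have "(\<integral>x. \<bar>smooth k r x - r x\<bar> \<partial>lborel) = (\<integral>x. \<bar>\<integral>z. F (z, x) \<partial>lborel\<bar> \<partial>lborel)"
      using eq integrable_partial_integral[OF F int1 int2]
      by (intro integral_cong_AE) auto
    also have "\<dots> \<le> (\<integral>z. gauss_kernel z * \<tau> (k *\<^sub>R z) \<partial>lborel)"
      using abs_partial_integral_le[OF F int1 int2] unfolding F_abs .
    finally show ?thesis .
  qed
  have lim: "(\<lambda>n. \<integral>z. gauss_kernel z * \<tau> (h n *\<^sub>R z) \<partial>lborel) \<longlonglongrightarrow> (\<integral>z. 0 \<partial>(lborel :: (real ^ 'd) measure))"
  proof (rule integral_dominated_convergence[where w = "\<lambda>z. gauss_kernel z * (2 * (\<integral>x. \<bar>r x\<bar> \<partial>lborel))"])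
    show "integrable lborel (\<lambda>z :: real ^ 'd. gauss_kernel z * (2 * (\<integral>x. \<bar>r x\<bar> \<partial>lborel)))"
      by (intro integrable_mult_left integrable_gauss_kernel)
    have "(\<lambda>n. gauss_kernel z * \<tau> (h n *\<^sub>R z)) \<longlonglongrightarrow> gauss_kernel z * 0" for z
      unfolding \<tau>_def using tendsto_scaleR[OF h(2) tendsto_const, of z]
      by (intro tendsto_mult tendsto_const translation_L1[OF r]) simp
    then show "AE z in lborel. (\<lambda>n. gauss_kernel z * \<tau> (h n *\<^sub>R z)) \<longlonglongrightarrow> 0" by simp
    show "AE z in lborel. norm (gauss_kernel z * \<tau> (h n *\<^sub>R z))
        \<le> gauss_kernel z * (2 * (\<integral>x. \<bar>r x\<bar> \<partial>lborel))" for n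
      using \<tau>_le \<tau>_nonneg
      by (auto simp: abs_mult less_imp_le intro!: AE_I2 mult_left_mono)
  qed measurable
  show ?thesis
  proof (rule tendsto_sandwich[OF _ _ tendsto_const])
    show "(\<lambda>n. \<integral>z. gauss_kernel z * \<tau> (h n *\<^sub>R z) \<partial>lborel) \<longlonglongrightarrow> 0" using lim by simp
    show "\<forall>\<^sub>F n in sequentially. 0 \<le> (\<integral>x. \<bar>smooth (h n) r x - r x\<bar> \<partial>lborel)" by simp
    show "\<forall>\<^sub>F n in sequentially. (\<integral>x. \<bar>smooth (h n) r x - r x\<bar> \<partial>lborel)
        \<le> (\<integral>z. gauss_kernel z * \<tau> (h n *\<^sub>R z) \<partial>lborel)"
      using h(1) by eventually_elim (rule bound)
  qed
qed

text \<open>The difference of the integrands is an S(bn - b) + an (S b - b) + b (an - a), with S the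
  smoothing. Each term has one factor bounded by \<open>R\<close> and one vanishing in L^1, the
  first because S is a contraction. Both sequences have to vary because the weights of the
  similarity sum change with the bandwidth.\<close>

lemma smooth_bilinear_tendsto:
  fixes a b :: "real ^ 'd \<Rightarrow> real" and an bn :: "nat \<Rightarrow> real ^ 'd \<Rightarrow> real"
  assumes h: "\<forall>\<^sub>F n in sequentially. 0 < h n" "h \<longlonglongrightarrow> 0"
    and an: "\<forall>\<^sub>F n in sequentially. integrable lborel (an n) \<and> (\<forall>x. \<bar>an n x\<bar> \<le> R)"
    and bn: "\<forall>\<^sub>F n in sequentially. integrable lborel (bn n)"
    and a: "integrable lborel a" and b: "integrable lborel b" "\<And>x. \<bar>b x\<bar> \<le> R"
    and a_lim: "(\<lambda>n. \<integral>x. \<bar>an n x - a x\<bar> \<partial>lborel) \<longlonglongrightarrow> 0"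
    and b_lim: "(\<lambda>n. \<integral>x. \<bar>bn n x - b x\<bar> \<partial>lborel) \<longlonglongrightarrow> 0"
  shows "(\<lambda>n. \<integral>x. an n x * smooth (h n) (bn n) x \<partial>lborel) \<longlonglongrightarrow> (\<integral>x. a x * b x \<partial>lborel)"
proof -
  have R: "0 \<le> R" using b(2)[of undefined] by linarith
  let ?E = "\<lambda>n. R * (\<integral>x. \<bar>bn n x - b x\<bar> \<partial>lborel) + R * (\<integral>x. \<bar>smooth (h n) b x - b x\<bar> \<partial>lborel)
      + R * (\<integral>x. \<bar>an n x - a x\<bar> \<partial>lborel)"
  have bd: "integrable lborel (\<lambda>x. u x * v x)"
    if "integrable lborel v" "u \<in> borel_measurable borel" "\<And>x. \<bar>u x\<bar> \<le> R" for u v :: "real ^ 'd \<Rightarrow> real"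
  proof (rule Bochner_Integration.integrable_bound)
    show "integrable lborel (\<lambda>x. R * v x)" using that by simp
    show "(\<lambda>x. u x * v x) \<in> borel_measurable lborel"
      using that by (auto dest: borel_measurable_integrable)
    show "AE x in lborel. norm (u x * v x) \<le> norm (R * v x)"
      using that(3) R by (auto simp: abs_mult intro!: mult_right_mono)
  qed
  have "\<forall>\<^sub>F n in sequentially.
      norm ((\<integral>x. an n x * smooth (h n) (bn n) x \<partial>lborel) - (\<integral>x. a x * b x \<partial>lborel)) \<le> ?E n"
    using h(1) an bn
  proof eventually_elim
    case (elim n)
    then have hn: "0 < h n" and ai: "integrable lborel (an n)" and aR: "\<And>x. \<bar>an n x\<bar> \<le> R"
      and bi: "integrable lborel (bn n)" by auto
    have [measurable]: "an n \<in> borel_measurable borel" "b \<in> borel_measurable borel"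
      using ai b by auto
    note sm [simp] = integrable_smooth[OF hn bi] integrable_smooth[OF hn b(1)]
    have 1: "integrable lborel (\<lambda>x. an n x * smooth (h n) (bn n) x)" by (rule bd) (use aR in auto)
    have 2: "integrable lborel (\<lambda>x. a x * b x)"
      using bd[of a b] a b by (simp add: mult.commute)
    have pt: "\<bar>an n x * smooth (h n) (bn n) x - a x * b x\<bar>
        \<le> R * \<bar>smooth (h n) (\<lambda>x. bn n x - b x) x\<bar> + R * \<bar>smooth (h n) b x - b x\<bar> + R * \<bar>an n x - a x\<bar>" for x
    proof -
      have "an n x * smooth (h n) (bn n) x - a x * b x
          = an n x * smooth (h n) (\<lambda>x. bn n x - b x) x + an n x * (smooth (h n) b x - b x)
            + b x * (an n x - a x)"
        by (simp add: smooth_diff[OF hn bi b(1)] algebra_simps)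
      also have "\<bar>\<dots>\<bar> \<le> \<bar>an n x\<bar> * \<bar>smooth (h n) (\<lambda>x. bn n x - b x) x\<bar>
          + \<bar>an n x\<bar> * \<bar>smooth (h n) b x - b x\<bar> + \<bar>b x\<bar> * \<bar>an n x - a x\<bar>"
        unfolding abs_mult[symmetric] by linarith
      also have "\<dots> \<le> R * \<bar>smooth (h n) (\<lambda>x. bn n x - b x) x\<bar>
          + R * \<bar>smooth (h n) b x - b x\<bar> + R * \<bar>an n x - a x\<bar>"
        using aR b(2) by (intro add_mono mult_right_mono) auto
      finally show ?thesis .
    qed
    have dint: "integrable lborel (\<lambda>x. bn n x - b x)" using bi b by simp
    have "norm ((\<integral>x. an n x * smooth (h n) (bn n) x \<partial>lborel) - (\<integral>x. a x * b x \<partial>lborel))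
        = \<bar>\<integral>x. an n x * smooth (h n) (bn n) x - a x * b x \<partial>lborel\<bar>"
      using 1 2 by simp
    also have "\<dots> \<le> (\<integral>x. \<bar>an n x * smooth (h n) (bn n) x - a x * b x\<bar> \<partial>lborel)"
      by (rule integral_abs_bound)
    also have "\<dots> \<le> (\<integral>x. R * \<bar>smooth (h n) (\<lambda>x. bn n x - b x) x\<bar> + R * \<bar>smooth (h n) b x - b x\<bar>
        + R * \<bar>an n x - a x\<bar> \<partial>lborel)"
      using 1 2 ai a b integrable_smooth[OF hn dint] by (intro integral_mono pt) auto
    also have "\<dots> = R * (\<integral>x. \<bar>smooth (h n) (\<lambda>x. bn n x - b x) x\<bar> \<partial>lborel)
        + R * (\<integral>x. \<bar>smooth (h n) b x - b x\<bar> \<partial>lborel) + R * (\<integral>x. \<bar>an n x - a x\<bar> \<partial>lborel)"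
      using ai a b integrable_smooth[OF hn dint] by simp
    also have "\<dots> \<le> ?E n"
      using smooth_L1_le[OF hn dint] R by (intro add_mono mult_left_mono order.refl) auto
    finally show ?case .
  qed
  moreover have "?E \<longlonglongrightarrow> R * 0 + R * 0 + R * 0"
    by (intro tendsto_add tendsto_mult tendsto_const a_lim b_lim smooth_L1_tendsto h b(1))
  ultimately have "(\<lambda>n. (\<integral>x. an n x * smooth (h n) (bn n) x \<partial>lborel) - (\<integral>x. a x * b x \<partial>lborel)) \<longlonglongrightarrow> 0"
    unfolding mult_zero_right add_0_left by (rule Lim_null_comparison)
  then show ?thesis by (rule LIM_zero_cancel)
qed

section \<open>Concentration of sample means\<close>

text \<open>For negative t, multiply 1 - t \<le> exp(-t) by exp t and use (1 + t + t^2)(1 - t) = 1 -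
  t^3 \<ge> 1.\<close>

lemma exp_le_quadratic:
  fixes t :: real
  assumes "\<bar>t\<bar> \<le> 1"
  shows "exp t \<le> 1 + t + t\<^sup>2"
proof (cases "0 \<le> t")
  case True
  then show ?thesis using exp_bound[of t] assms by simp
next
  case False
  have "exp t * (1 + (- t)) \<le> exp t * exp (- t)"
    by (intro mult_left_mono exp_ge_add_one_self) auto
  also have "exp t * exp (- t) = 1" by (simp add: exp_minus)
  also have "1 \<le> (1 + t + t\<^sup>2) * (1 - t)"
  proof -
    have "t\<^sup>2 * t \<le> 0" using False by (intro mult_nonneg_nonpos) auto
    then show ?thesis by (simp add: algebra_simps power2_eq_square)
  qed
  finally show ?thesis using False by simp
qed

text \<open>Nonnegativity gives \<open>Z\<^sup>2 \<le> b Z\<close>, so the exponent involves the mean bound \<open>m\<close> in place of a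
  second factor \<open>b\<close>. This matters since \<open>b\<close> is of order \<open>h\<^sup>-\<^sup>d\<close> for kernel estimates.\<close>

lemma (in prob_space) exp_deviation_bound:
  fixes Z :: "'i \<Rightarrow> 'a \<Rightarrow> real" and a b m s \<mu> :: real
  assumes I: "finite I" and indep: "indep_vars (\<lambda>_. borel) Z I"
    and bnd: "\<And>i \<omega>. i \<in> I \<Longrightarrow> \<omega> \<in> space M \<Longrightarrow> 0 \<le> Z i \<omega> \<and> Z i \<omega> \<le> b"
    and mean: "\<And>i. i \<in> I \<Longrightarrow> expectation (Z i) = \<mu>" and m: "\<mu> \<le> m" and b: "0 < b" and s: "\<bar>s\<bar> * b \<le> 1"
  shows "prob {\<omega>\<in>space M. a \<le> s * ((\<Sum>i\<in>I. Z i \<omega>) - card I * \<mu>)} \<le> exp (card I * (s\<^sup>2 * b * m) - a)"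
proof -
  have rv [measurable]: "random_variable borel (Z i)" if "i \<in> I" for i
    using indep that by (auto simp: indep_vars_def)
  have Zint: "integrable M (Z i)" if "i \<in> I" for i
    using bnd[OF that] that by (intro integrable_const_bound[where B = b]) auto
  have Eint: "integrable M (\<lambda>\<omega>. exp (s * Z i \<omega>))" if "i \<in> I" for i
  proof (intro integrable_const_bound[where B = "exp 1"])
    have "s * Z i \<omega> \<le> 1" if "\<omega> \<in> space M" for \<omega>
    proof -
      have "s * Z i \<omega> \<le> \<bar>s\<bar> * b"
        using bnd[OF \<open>i \<in> I\<close> that] by (intro mult_mono) auto
      with s show ?thesis by simp
    qed
    then show "AE \<omega> in M. norm (exp (s * Z i \<omega>)) \<le> exp 1" by simp
  qed (use that in measurable)
  have E: "expectation (\<lambda>\<omega>. exp (s * Z i \<omega>)) \<le> exp (s * \<mu> + s\<^sup>2 * b * m)" if i: "i \<in> I" for i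
  proof -
    have "expectation (\<lambda>\<omega>. exp (s * Z i \<omega>)) \<le> expectation (\<lambda>\<omega>. 1 + s * Z i \<omega> + s\<^sup>2 * b * Z i \<omega>)"
    proof (rule integral_mono)
      fix \<omega> assume \<omega>: "\<omega> \<in> space M"
      have "\<bar>s * Z i \<omega>\<bar> \<le> \<bar>s\<bar> * b"
        using bnd[OF i \<omega>] by (auto simp: abs_mult intro!: mult_left_mono)
      then have "exp (s * Z i \<omega>) \<le> 1 + s * Z i \<omega> + (s * Z i \<omega>)\<^sup>2"
        using s by (intro exp_le_quadratic) auto
      also have "(s * Z i \<omega>)\<^sup>2 = s\<^sup>2 * (Z i \<omega> * Z i \<omega>)"
        by (simp add: power2_eq_square)
      also have "\<dots> \<le> s\<^sup>2 * (b * Z i \<omega>)"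
        using bnd[OF i \<omega>] by (intro mult_left_mono mult_right_mono) auto
      finally show "exp (s * Z i \<omega>) \<le> 1 + s * Z i \<omega> + s\<^sup>2 * b * Z i \<omega>" by simp
    qed (use Eint[OF i] Zint[OF i] in auto)
    also have "\<dots> = 1 + s * \<mu> + s\<^sup>2 * b * \<mu>"
      using Zint[OF i] mean[OF i] by (simp add: prob_space)
    also have "\<dots> \<le> 1 + (s * \<mu> + s\<^sup>2 * b * m)"
      using m b by (simp add: mult_left_mono)
    also have "\<dots> \<le> exp (s * \<mu> + s\<^sup>2 * b * m)" by (rule exp_ge_add_one_self)
    finally show ?thesis .
  qed
  have indep': "indep_vars (\<lambda>_. borel) (\<lambda>i \<omega>. exp (s * Z i \<omega>)) I"
    by (rule indep_vars_compose2[OF indep]) measurable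
  \<comment> \<open>Chernoff's method: the deviation event says that the product \<open>?u\<close>
    reaches \<open>?c\<close>. Markov's inequality applies to \<open>?u\<close>, whose mean
    factorises by independence. The sign of \<open>s\<close> selects the tail.\<close>
  let ?u = "\<lambda>\<omega>. \<Prod>i\<in>I. exp (s * Z i \<omega>)"
  let ?c = "exp (a + s * (card I * \<mu>))"
  have uint: "integrable M ?u" by (rule indep_vars_integrable[OF I indep' Eint])
  have "{\<omega>\<in>space M. a \<le> s * ((\<Sum>i\<in>I. Z i \<omega>) - card I * \<mu>)} = {\<omega>\<in>space M. ?c \<le> ?u \<omega>}"
    by (auto simp: exp_sum[OF I, symmetric] sum_distrib_left[symmetric] algebra_simps)
  also have "prob \<dots> \<le> expectation ?u / ?c"
    by (rule integral_Markov_inequality_measure[OF uint, of "{}"]) (auto intro!: prod_nonneg)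
  also have "\<dots> = (\<Prod>i\<in>I. expectation (\<lambda>\<omega>. exp (s * Z i \<omega>))) / ?c"
    by (simp add: indep_vars_lebesgue_integral[OF I indep' Eint])
  also have "\<dots> \<le> (\<Prod>i\<in>I. exp (s * \<mu> + s\<^sup>2 * b * m)) / ?c"
    by (intro divide_right_mono prod_mono conjI E integral_nonneg_AE) auto
  also have "\<dots> = exp (card I * (s\<^sup>2 * b * m) - a)"
    by (simp add: exp_of_nat_mult[symmetric] exp_diff[symmetric] algebra_simps)
  finally show ?thesis .
qed

lemma (in prob_space) bernstein_inequality:
  fixes Z :: "'i \<Rightarrow> 'a \<Rightarrow> real" and b m \<mu> \<epsilon> :: real
  assumes I: "finite I" "I \<noteq> {}" and indep: "indep_vars (\<lambda>_. borel) Z I"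
    and bnd: "\<And>i \<omega>. i \<in> I \<Longrightarrow> \<omega> \<in> space M \<Longrightarrow> 0 \<le> Z i \<omega> \<and> Z i \<omega> \<le> b"
    and mean: "\<And>i. i \<in> I \<Longrightarrow> expectation (Z i) = \<mu>" and m: "\<mu> \<le> m" and b: "0 < b"
    and e: "0 < \<epsilon>" "\<epsilon> \<le> 2 * m"
  shows "prob {\<omega>\<in>space M. \<epsilon> \<le> \<bar>(\<Sum>i\<in>I. Z i \<omega>) / card I - \<mu>\<bar>} \<le> 2 * exp (- (card I * \<epsilon>\<^sup>2 / (4 * b * m)))"
proof -
  have [measurable]: "random_variable borel (Z i)" if "i \<in> I" for i
    using indep that by (auto simp: indep_vars_def)
  have m0: "0 < m" using e by linarith
  have card: "0 < card I" using I by (simp add: card_gt_0_iff)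
  \<comment> \<open>This \<open>s\<close> minimises s^2 b m - s \<epsilon>, with minimum
    -\<epsilon>^2 / (4 b m); the assumption \<epsilon> \<le> 2 m is what makes s b \<le> 1. The
    lower tail comes from -s.\<close>
  define s where "s = \<epsilon> / (2 * b * m)"
  have s0: "0 < s" using e b m0 by (simp add: s_def)
  have sb: "\<bar>s\<bar> * b \<le> 1" "\<bar>- s\<bar> * b \<le> 1"
    using e b m0 by (auto simp: s_def field_simps)
  let ?A = "\<lambda>s :: real. {\<omega>\<in>space M. card I * \<bar>s\<bar> * \<epsilon> \<le> s * ((\<Sum>i\<in>I. Z i \<omega>) - card I * \<mu>)}"
  have expo: "card I * (s\<^sup>2 * b * m) - card I * \<bar>s\<bar> * \<epsilon> = - (card I * \<epsilon>\<^sup>2 / (4 * b * m))"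
    using b m0 e by (simp add: s_def power2_eq_square field_simps)
  have sub: "{\<omega>\<in>space M. \<epsilon> \<le> \<bar>(\<Sum>i\<in>I. Z i \<omega>) / card I - \<mu>\<bar>} \<subseteq> ?A s \<union> ?A (- s)"
  proof
    fix \<omega> assume \<omega>: "\<omega> \<in> {\<omega>\<in>space M. \<epsilon> \<le> \<bar>(\<Sum>i\<in>I. Z i \<omega>) / card I - \<mu>\<bar>}"
    define D where "D = (\<Sum>i\<in>I. Z i \<omega>) - card I * \<mu>"
    have "(\<Sum>i\<in>I. Z i \<omega>) / card I - \<mu> = D / card I" using card by (simp add: D_def field_simps)
    then have "card I * \<epsilon> \<le> \<bar>D\<bar>" using \<omega> card by (simp add: abs_divide field_simps)
    then have "s * (card I * \<epsilon>) \<le> s * \<bar>D\<bar>" using s0 by (intro mult_left_mono) auto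
    then have "s * (card I * \<epsilon>) \<le> s * D \<or> s * (card I * \<epsilon>) \<le> - s * D" by (cases "0 \<le> D") auto
    then show "\<omega> \<in> ?A s \<union> ?A (- s)" using \<omega> s0 by (auto simp: D_def mult_ac)
  qed
  have "prob {\<omega>\<in>space M. \<epsilon> \<le> \<bar>(\<Sum>i\<in>I. Z i \<omega>) / card I - \<mu>\<bar>} \<le> prob (?A s \<union> ?A (- s))"
    by (rule finite_measure_mono[OF sub]) measurable
  also have "\<dots> \<le> prob (?A s) + prob (?A (- s))"
    by (rule measure_Un_le) measurable
  also have "\<dots> \<le> exp (card I * (s\<^sup>2 * b * m) - card I * \<bar>s\<bar> * \<epsilon>)
      + exp (card I * ((- s)\<^sup>2 * b * m) - card I * \<bar>- s\<bar> * \<epsilon>)"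
    by (intro add_mono exp_deviation_bound I indep bnd mean m b sb)
  finally show ?thesis using expo by simp
qed

section \<open>Independent samples and arrays of sample means\<close>

locale iid_sample = prob_space M for M :: "'w measure" +
  fixes N :: "'z measure" and Z0 :: "'w \<Rightarrow> 'z" and Z :: "nat \<Rightarrow> 'w \<Rightarrow> 'z"
  assumes Z0 [measurable]: "Z0 \<in> measurable M N"
    and indep: "indep_vars (\<lambda>_. N) Z {1..}"
    and ident: "\<And>l. l \<ge> 1 \<Longrightarrow> distr M N (Z l) = distr M N Z0"
begin

lemma Z_measurable: "l \<ge> 1 \<Longrightarrow> Z l \<in> measurable M N"
  using indep by (auto simp: indep_vars_def)

lemma expectation_sample:
  assumes "\<phi> \<in> borel_measurable N" "l \<ge> 1"
  shows "expectation (\<lambda>\<omega>. \<phi> (Z l \<omega>)) = (expectation (\<lambda>\<omega>. \<phi> (Z0 \<omega>)) :: real)"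
  using integral_distr[OF Z_measurable[OF assms(2)] assms(1)] integral_distr[OF Z0 assms(1)]
    ident[OF assms(2)] by simp

lemma sample_mean_deviation:
  fixes \<phi> :: "'z \<Rightarrow> real" and b m \<epsilon> :: real
  assumes \<phi> [measurable]: "\<phi> \<in> borel_measurable N"
    and bnd: "\<And>z. z \<in> space N \<Longrightarrow> 0 \<le> \<phi> z \<and> \<phi> z \<le> b"
    and m: "expectation (\<lambda>\<omega>. \<phi> (Z0 \<omega>)) \<le> m" and b: "0 < b" and e: "0 < \<epsilon>" "\<epsilon> \<le> 2 * m" and n: "n \<ge> 1"
  shows "prob {\<omega>\<in>space M. \<epsilon> \<le> \<bar>(\<Sum>l = 1..n. \<phi> (Z l \<omega>)) / n - expectation (\<lambda>\<omega>. \<phi> (Z0 \<omega>))\<bar>}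
    \<le> 2 * exp (- (n * \<epsilon>\<^sup>2 / (4 * b * m)))"
proof -
  have "indep_vars (\<lambda>_. borel) (\<lambda>l \<omega>. \<phi> (Z l \<omega>)) {1..n}"
    by (rule indep_vars_compose2[OF indep_vars_subset[OF indep]]) auto
  then show ?thesis
    using bernstein_inequality[of "{1..n}" "\<lambda>l \<omega>. \<phi> (Z l \<omega>)" b "expectation (\<lambda>\<omega>. \<phi> (Z0 \<omega>))" m \<epsilon>]
      measurable_space[OF Z_measurable] bnd m b e n expectation_sample[OF \<phi>]
    by auto
qed

text \<open>The growth condition on \<open>b\<close> turns the Bernstein bound into exp(-c (ln
  n)^2), which beats every power of \<open>n\<close>. The union over polynomially many functions
  therefore stays summable, and Borel-Cantelli applies although both the functions and their range
  vary with \<open>n\<close>.\<close>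

lemma sample_means_AE:
  fixes \<phi> :: "nat \<Rightarrow> 'i \<Rightarrow> 'z \<Rightarrow> real" and b :: "nat \<Rightarrow> real" and m B C p \<epsilon> :: real
  assumes S: "\<And>n. finite (S n)" "\<forall>\<^sub>F n in sequentially. real (card (S n)) \<le> C * real n powr p"
    and \<phi> [measurable]: "\<And>n i. \<phi> n i \<in> borel_measurable N"
    and bnd: "\<forall>\<^sub>F n in sequentially. \<forall>i\<in>S n. \<forall>z\<in>space N. 0 \<le> \<phi> n i z \<and> \<phi> n i z \<le> b n"
    and m: "\<forall>\<^sub>F n in sequentially. \<forall>i\<in>S n. expectation (\<lambda>\<omega>. \<phi> n i (Z0 \<omega>)) \<le> m"
    and b: "\<forall>\<^sub>F n in sequentially. 0 < b n \<and> b n * (ln (real n))\<^sup>2 \<le> B * real n" and B: "0 < B"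
    and e: "0 < \<epsilon>" "\<epsilon> \<le> 2 * m"
  shows "AE \<omega> in M. \<forall>\<^sub>F n in sequentially. \<forall>i\<in>S n.
    \<bar>(\<Sum>l = 1..n. \<phi> n i (Z l \<omega>)) / n - expectation (\<lambda>\<omega>. \<phi> n i (Z0 \<omega>))\<bar> < \<epsilon>"
proof -
  have m0: "0 < m" using e by linarith
  define c where "c = \<epsilon>\<^sup>2 / (4 * B * m)"
  have c: "0 < c" using e m0 B by (simp add: c_def)
  define D where "D n i = {\<omega>\<in>space M. \<epsilon> \<le> \<bar>(\<Sum>l = 1..n. \<phi> n i (Z l \<omega>)) / n
      - expectation (\<lambda>\<omega>. \<phi> n i (Z0 \<omega>))\<bar>}" for n i
  define A where "A n = (\<Union>i\<in>S n. D n i)" for n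
  have [measurable]: "(\<lambda>\<omega>. \<phi> n i (Z l \<omega>)) \<in> borel_measurable M" if "l \<in> {1..k}" for n i l k
    using that by (intro measurable_compose[OF Z_measurable \<phi>]) auto
  have D_sets [measurable]: "D n i \<in> sets M" for n i
    unfolding D_def by measurable
  have A_sets: "A n \<in> sets M" for n
    unfolding A_def using S by (intro sets.finite_UN) auto
  \<comment> \<open>Of the exponent p + 2, p pays for the number of functions and 2 makes the bound
    summable.\<close>
  have lim: "(\<lambda>n. real n powr (p + 2) * exp (- c * (ln (real n))\<^sup>2)) \<longlonglongrightarrow> 0"
    using c by real_asymp
  have "\<forall>\<^sub>F n in sequentially. real n powr (p + 2) * exp (- c * (ln (real n))\<^sup>2) < 1"
    using order_tendstoD(2)[OF lim, of 1] by simp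
  then have "\<forall>\<^sub>F n in sequentially. norm (prob (A n)) \<le> 2 * \<bar>C\<bar> * inverse (real n ^ 2)"
    using S(2) bnd m b eventually_ge_at_top[of 1]
  proof eventually_elim
    case (elim n)
    have "prob (D n i) \<le> 2 * exp (- c * (ln (real n))\<^sup>2)" if "i \<in> S n" for i
    proof -
      have "prob (D n i) \<le> 2 * exp (- (n * \<epsilon>\<^sup>2 / (4 * b n * m)))"
        unfolding D_def using elim that e by (intro sample_mean_deviation) auto
      also have "- (n * \<epsilon>\<^sup>2 / (4 * b n * m)) \<le> - c * (ln (real n))\<^sup>2"
      proof -
        have "c * (ln (real n))\<^sup>2 * (4 * b n * m) = \<epsilon>\<^sup>2 / B * (b n * (ln (real n))\<^sup>2)"
          using m0 B by (simp add: c_def field_simps)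
        also have "\<dots> \<le> \<epsilon>\<^sup>2 / B * (B * real n)"
          using elim B by (intro mult_left_mono) auto
        also have "\<dots> = n * \<epsilon>\<^sup>2" using B by simp
        finally have "c * (ln (real n))\<^sup>2 \<le> n * \<epsilon>\<^sup>2 / (4 * b n * m)"
          using elim m0 by (subst pos_le_divide_eq) auto
        then show ?thesis by simp
      qed
      finally show ?thesis by simp
    qed
    then have "prob (A n) \<le> (\<Sum>i\<in>S n. 2 * exp (- c * (ln (real n))\<^sup>2))"
      unfolding A_def using S(1)
      by (intro order.trans[OF finite_measure_subadditive_finite] sum_mono) auto
    also have "\<dots> = card (S n) * (2 * exp (- c * (ln (real n))\<^sup>2))" by simp
    also have "\<dots> \<le> \<bar>C\<bar> * real n powr p * (2 * exp (- c * (ln (real n))\<^sup>2))"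
    proof (intro mult_right_mono)
      have "C * real n powr p \<le> \<bar>C\<bar> * real n powr p" by (intro mult_right_mono) auto
      with elim show "real (card (S n)) \<le> \<bar>C\<bar> * real n powr p" by linarith
    qed auto
    also have "\<dots> = 2 * \<bar>C\<bar> * (real n powr (p + 2) * exp (- c * (ln (real n))\<^sup>2)) * inverse (real n ^ 2)"
      using elim by (simp add: powr_add powr_numeral field_simps)
    also have "\<dots> \<le> 2 * \<bar>C\<bar> * 1 * inverse (real n ^ 2)"
      using elim by (intro mult_right_mono mult_left_mono) auto
    finally show ?case by simp
  qed
  moreover have "summable (\<lambda>n. 2 * \<bar>C\<bar> * inverse (real n ^ 2))"
    by (intro summable_mult inverse_power_summable) auto
  ultimately have "summable (\<lambda>n. prob (A n))"
    by (rule summable_comparison_test_ev)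
  then have "AE \<omega> in M. \<forall>\<^sub>F n in sequentially. \<omega> \<in> space M - A n"
    by (intro borel_cantelli_AE1 A_sets) (auto simp: emeasure_eq_measure)
  then show ?thesis
  proof eventually_elim
    case (elim \<omega>)
    then show ?case by eventually_elim (auto simp: A_def D_def not_le)
  qed
qed

end

section \<open>Uniform concentration of weighted kernel estimates\<close>

text \<open>Put L = -ln h. Once L \<ge> 1, the limit of L / (n h^(d + 2\<gamma>)) makes n h^(d +
  2\<gamma>) at least 1. The growth of L / ln ln n gives ln ln n \<le> \<gamma> L, that is, (ln n)^2
  \<le> h^(-2\<gamma>). The product of the two bounds is the claim.\<close>

lemma bandwidth_eventually:
  assumes h: "bandwidth_condition d \<gamma> h" and \<gamma>: "0 < \<gamma>"
  shows "\<forall>\<^sub>F n in sequentially. 0 < h n \<and> h n \<le> 1 \<and> (ln (real n))\<^sup>2 \<le> real n * h n ^ d"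
proof -
  have pos: "\<And>n. n \<ge> 1 \<Longrightarrow> 0 < h n" and h0: "h \<longlonglongrightarrow> 0"
    and h1: "(\<lambda>n. - ln (h n) / (real n * h n powr (real d + 2 * \<gamma>))) \<longlonglongrightarrow> 0"
    and h2: "filterlim (\<lambda>n. - ln (h n) / ln (ln (real n))) at_top sequentially"
    using h by (auto simp: bandwidth_condition_def)
  have lnln: "\<forall>\<^sub>F n :: nat in sequentially. 0 < ln (ln (real n))" by real_asymp
  have lnpos: "\<forall>\<^sub>F n :: nat in sequentially. 0 < ln (real n)" by real_asymp
  have "\<forall>\<^sub>F n in sequentially. h n < exp (- 1)"
    using order_tendstoD(2)[OF h0, of "exp (- 1)"] by simp
  moreover have "\<forall>\<^sub>F n in sequentially. - ln (h n) / (real n * h n powr (real d + 2 * \<gamma>)) < 1"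
    using order_tendstoD(2)[OF h1, of 1] by simp
  moreover have "\<forall>\<^sub>F n in sequentially. 1 / \<gamma> \<le> - ln (h n) / ln (ln (real n))"
    using h2 by (simp add: filterlim_at_top)
  ultimately show ?thesis
    using lnln lnpos eventually_ge_at_top[of 1]
  proof eventually_elim
    case (elim n)
    define L where "L = - ln (h n)"
    have hn: "0 < h n" using pos elim by simp
    have "ln (h n) < - 1" using elim hn ln_less_cancel_iff[of "h n" "exp (- 1)"] by simp
    then have L: "1 \<le> L" by (simp add: L_def)
    have h_exp: "h n powr x = exp (- x * L)" for x
      using hn by (simp add: powr_def L_def)
    have "ln (ln (real n)) / \<gamma> \<le> L" using elim \<gamma> by (simp add: L_def field_simps)
    then have LL: "ln (ln (real n)) \<le> \<gamma> * L" using \<gamma> by (simp add: field_simps)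
    have "1 \<le> L" by fact
    also have "L < real n * h n powr (real d + 2 * \<gamma>)"
      using elim hn by (simp add: L_def field_simps)
    finally have low: "1 \<le> real n * h n powr (real d + 2 * \<gamma>)" by simp
    have "(ln (real n))\<^sup>2 = exp (2 * ln (ln (real n)))"
      using elim by (simp add: exp_double)
    also have "\<dots> \<le> exp (2 * (\<gamma> * L))" using LL by simp
    also have "\<dots> \<le> (real n * h n powr (real d + 2 * \<gamma>)) * exp (2 * (\<gamma> * L))"
      using mult_right_mono[OF low, of "exp (2 * (\<gamma> * L))"] by simp
    also have "\<dots> = real n * h n powr real d"
      by (simp add: h_exp exp_add[symmetric] algebra_simps)
    also have "h n powr real d = h n ^ d" using hn by (simp add: powr_realpow)
    finally have main: "(ln (real n))\<^sup>2 \<le> real n * h n ^ d" .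
    have "exp (- 1) \<le> (1 :: real)" by simp
    then have "h n \<le> 1" using elim by linarith
    with main hn show ?case by simp
  qed
qed

text \<open>The grid is the lattice of spacing 1/k: rounding down moves each coordinate by at most
  1/k, and the l^1 norm dominates the Euclidean one. With m equal to R k rounded up, each coordinate
  takes 2m + 1 \<le> (2R + 3) k values.\<close>

lemma box_grid:
  fixes R :: real and k :: nat
  assumes R: "0 \<le> R" and k: "1 \<le> k"
  obtains G :: "(real ^ 'd) set" where "finite G" "real (card G) \<le> ((2 * R + 3) * real k) ^ CARD('d)"
    "\<And>x. (\<And>i. \<bar>x $ i\<bar> \<le> R) \<Longrightarrow> \<exists>p\<in>G. norm (x - p) \<le> real CARD('d) / real k"
proof
  define m where "m = \<lceil>R * real k\<rceil>"
  define V where "V = (UNIV :: 'd set) \<rightarrow>\<^sub>E {- m..m}"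
  define G where "G = (\<lambda>v. (\<chi> i. real_of_int (v i) / real k) :: real ^ 'd) ` V"
  have V: "finite V" by (auto simp: V_def intro!: finite_PiE)
  then show "finite G" by (simp add: G_def)
  have "0 \<le> R * real k" using R by simp
  then have m0: "0 \<le> m" unfolding m_def by linarith
  have "real (card G) \<le> real (card V)"
    unfolding G_def using card_image_le[OF V] by simp
  also have "card V = nat (2 * m + 1) ^ CARD('d)"
    by (simp add: V_def card_PiE)
  also have "real (nat (2 * m + 1) ^ CARD('d)) = (2 * real_of_int m + 1) ^ CARD('d)"
    using m0 by simp
  also have "\<dots> \<le> ((2 * R + 3) * real k) ^ CARD('d)"
  proof (rule power_mono)
    have "real_of_int m \<le> R * real k + 1" unfolding m_def by linarith
    then show "2 * real_of_int m + 1 \<le> (2 * R + 3) * real k"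
      using k by (simp add: algebra_simps)
  qed (use m0 in simp)
  finally show "real (card G) \<le> ((2 * R + 3) * real k) ^ CARD('d)" .
  fix x :: "real ^ 'd" assume x: "\<And>i. \<bar>x $ i\<bar> \<le> R"
  define v where "v i = \<lfloor>x $ i * real k\<rfloor>" for i
  have "v i \<in> {- m..m}" for i
  proof -
    have "\<bar>x $ i * real k\<bar> \<le> R * real k"
      using x[of i] by (simp add: abs_mult mult_right_mono)
    then show ?thesis unfolding v_def m_def by (simp add: floor_le_iff le_floor_iff) linarith
  qed
  then have "v \<in> V" by (simp add: V_def PiE_iff)
  then have p: "(\<chi> i. real_of_int (v i) / real k) \<in> G" by (auto simp: G_def)
  have "norm (x - (\<chi> i. real_of_int (v i) / real k)) \<le> (\<Sum>i\<in>UNIV. \<bar>(x - (\<chi> i. real_of_int (v i) / real k)) $ i\<bar>)"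
    by (rule norm_le_l1_cart)
  also have "\<dots> \<le> (\<Sum>i\<in>(UNIV :: 'd set). 1 / real k)"
  proof (rule sum_mono)
    fix i :: 'd
    have "\<bar>x $ i * real k - real_of_int (v i)\<bar> \<le> 1" unfolding v_def by linarith
    then have "\<bar>x $ i * real k - real_of_int (v i)\<bar> / real k \<le> 1 / real k"
      by (rule divide_right_mono) simp
    moreover have "x $ i - real_of_int (v i) / real k = (x $ i * real k - real_of_int (v i)) / real k"
      using k by (simp add: field_simps)
    ultimately show "\<bar>(x - (\<chi> i. real_of_int (v i) / real k)) $ i\<bar> \<le> 1 / real k"
      by (simp add: abs_divide)
  qed
  also have "\<dots> = real CARD('d) / real k" by simp
  finally show "\<exists>p\<in>G. norm (x - p) \<le> real CARD('d) / real k" using p by blast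
qed

text \<open>The weight sees the label as well as the point, so one concentration result covers the
  density estimate (weight 1), the class estimates (a label indicator) and the inner similarity sums
  (a label indicator times a function of the point).\<close>

definition weighted_kde ::
  "nat \<Rightarrow> real \<Rightarrow> (nat \<Rightarrow> (real ^ 'd) \<times> nat) \<Rightarrow> ((real ^ 'd) \<times> nat \<Rightarrow> real) \<Rightarrow> real ^ 'd \<Rightarrow> real" where
  "weighted_kde n h zs w x = (\<Sum>l = 1..n. scaled_kernel h (x - fst (zs l)) * w (zs l)) / real n"

lemma weighted_kde_lipschitz:
  fixes zs :: "nat \<Rightarrow> (real ^ 'd) \<times> nat"
  assumes h: "0 < h" and w: "\<And>z. 0 \<le> w z \<and> w z \<le> W" and n: "1 \<le> n"
  shows "\<bar>weighted_kde n h zs w x - weighted_kde n h zs w y\<bar> \<le> W * (norm (x - y) / h ^ (CARD('d) + 1))"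
proof -
  let ?e = "norm (x - y) / h ^ (CARD('d) + 1)"
  have "\<bar>weighted_kde n h zs w x - weighted_kde n h zs w y\<bar>
      = \<bar>\<Sum>l = 1..n. (scaled_kernel h (x - fst (zs l)) - scaled_kernel h (y - fst (zs l))) * w (zs l)\<bar> / real n"
    by (simp add: weighted_kde_def left_diff_distrib sum_subtractf diff_divide_distrib[symmetric] abs_divide)
  also have "\<dots> \<le> (\<Sum>l = 1..n. \<bar>(scaled_kernel h (x - fst (zs l)) - scaled_kernel h (y - fst (zs l))) * w (zs l)\<bar>) / real n"
    by (intro divide_right_mono sum_abs) auto
  also have "\<dots> \<le> (\<Sum>l = 1..n. W * ?e) / real n"
  proof (intro divide_right_mono sum_mono)
    fix l
    have "\<bar>scaled_kernel h (x - fst (zs l)) - scaled_kernel h (y - fst (zs l))\<bar> \<le> ?e"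
      using scaled_kernel_lipschitz[OF h, of "x - fst (zs l)" "y - fst (zs l)"] by simp
    then have "\<bar>scaled_kernel h (x - fst (zs l)) - scaled_kernel h (y - fst (zs l))\<bar> * \<bar>w (zs l)\<bar> \<le> ?e * W"
      using w[of "zs l"] h by (intro mult_mono) auto
    then show "\<bar>(scaled_kernel h (x - fst (zs l)) - scaled_kernel h (y - fst (zs l))) * w (zs l)\<bar> \<le> W * ?e"
      by (simp add: abs_mult mult.commute)
  qed simp
  also have "\<dots> = W * ?e" using n by simp
  finally show ?thesis .
qed

locale labelled_sample = iid_sample M "borel \<Otimes>\<^sub>M count_space UNIV" Z0 Z
  for M :: "'w measure" and Z0 :: "'w \<Rightarrow> (real ^ 'd) \<times> nat" and Z :: "nat \<Rightarrow> 'w \<Rightarrow> (real ^ 'd) \<times> nat"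
begin

definition weighted_mean :: "real \<Rightarrow> ((real ^ 'd) \<times> nat \<Rightarrow> real) \<Rightarrow> real ^ 'd \<Rightarrow> real" where
  "weighted_mean h w x = expectation (\<lambda>\<omega>. scaled_kernel h (x - fst (Z0 \<omega>)) * w (Z0 \<omega>))"

lemma weighted_mean_lipschitz:
  assumes h: "0 < h" and w: "\<And>z. 0 \<le> w z \<and> w z \<le> W"
    and [measurable]: "w \<in> borel_measurable (borel \<Otimes>\<^sub>M count_space UNIV)"
  shows "\<bar>weighted_mean h w x - weighted_mean h w y\<bar> \<le> W * (norm (x - y) / h ^ (CARD('d) + 1))"
proof -
  let ?e = "norm (x - y) / h ^ (CARD('d) + 1)"
  have W: "0 \<le> W" using w[of undefined] by linarith
  have int: "integrable M (\<lambda>\<omega>. scaled_kernel h (x - fst (Z0 \<omega>)) * w (Z0 \<omega>))" for x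
  proof (rule integrable_const_bound[where B = "1 / h ^ CARD('d) * W"])
    show "AE \<omega> in M. norm (scaled_kernel h (x - fst (Z0 \<omega>)) * w (Z0 \<omega>)) \<le> 1 / h ^ CARD('d) * W"
      using w h unfolding norm_mult
      by (intro AE_I2 mult_mono) (auto intro: scaled_kernel_le)
  qed measurable
  have "\<bar>weighted_mean h w x - weighted_mean h w y\<bar>
      = \<bar>expectation (\<lambda>\<omega>. (scaled_kernel h (x - fst (Z0 \<omega>)) - scaled_kernel h (y - fst (Z0 \<omega>))) * w (Z0 \<omega>))\<bar>"
    using int by (simp add: weighted_mean_def left_diff_distrib)
  also have "\<dots> \<le> expectation (\<lambda>\<omega>. \<bar>(scaled_kernel h (x - fst (Z0 \<omega>)) - scaled_kernel h (y - fst (Z0 \<omega>))) * w (Z0 \<omega>)\<bar>)"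
    by (rule integral_abs_bound)
  also have "\<dots> \<le> expectation (\<lambda>\<omega>. W * ?e)"
  proof (rule integral_mono)
    fix \<omega>
    have "\<bar>scaled_kernel h (x - fst (Z0 \<omega>)) - scaled_kernel h (y - fst (Z0 \<omega>))\<bar> \<le> ?e"
      using scaled_kernel_lipschitz[OF h, of "x - fst (Z0 \<omega>)" "y - fst (Z0 \<omega>)"] by simp
    then have "\<bar>scaled_kernel h (x - fst (Z0 \<omega>)) - scaled_kernel h (y - fst (Z0 \<omega>))\<bar> * \<bar>w (Z0 \<omega>)\<bar> \<le> ?e * W"
      using w[of "Z0 \<omega>"] h by (intro mult_mono) auto
    then show "\<bar>(scaled_kernel h (x - fst (Z0 \<omega>)) - scaled_kernel h (y - fst (Z0 \<omega>))) * w (Z0 \<omega>)\<bar> \<le> W * ?e"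
      by (simp add: abs_mult mult.commute)
  qed (use int in \<open>auto simp: left_diff_distrib\<close>)
  finally show ?thesis by (simp add: prob_space)
qed

text \<open>From n h^d \<ge> 1 and h \<le> 1 follows h \<ge> 1/n, so the Lipschitz constant h^(-d-1)
  of the scaled kernel is at most n^2. A grid of mesh of order n^(-3) therefore leaves an error of
  order 1/n, and its size is only of order n^(3d).\<close>

lemma weighted_kde_uniform_AE:
  assumes bw: "bandwidth_condition CARD('d) \<gamma> h" "0 < \<gamma>"
    and w_meas [measurable]: "\<And>n. w n \<in> borel_measurable (borel \<Otimes>\<^sub>M count_space UNIV)"
    and w: "\<And>n z. 0 \<le> w n z \<and> w n z \<le> W"
    and m: "\<And>n x. 1 \<le> n \<Longrightarrow> weighted_mean (h n) (w n) x \<le> m"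
    and e: "0 < \<epsilon>" and R: "0 \<le> R"
  shows "AE \<omega> in M. \<forall>\<^sub>F n in sequentially. \<forall>x. (\<forall>i. \<bar>x $ i\<bar> \<le> R) \<longrightarrow>
    \<bar>weighted_kde n (h n) (\<lambda>l. Z l \<omega>) (w n) x - weighted_mean (h n) (w n) x\<bar> \<le> \<epsilon>"
proof -
  define d where "d = CARD('d)"
  have d: "1 \<le> d" by (simp add: d_def Suc_le_eq)
  \<comment> \<open>The maxima make the constants admissible for the estimate of sample means:
    \<open>W'\<close> is positive, and \<epsilon>/2 \<le> 2 m'.\<close>
  define W' where "W' = max 1 W"
  have W': "1 \<le> W'" "W \<le> W'" by (auto simp: W'_def)
  define m' where "m' = max m \<epsilon>"
  have m': "m \<le> m'" "\<epsilon> \<le> m'" by (auto simp: m'_def)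
  have "\<exists>G :: (real ^ 'd) set. finite G \<and> (1 \<le> n \<longrightarrow> real (card G) \<le> ((2 * R + 3) * real (n ^ 3)) ^ d \<and>
      (\<forall>x. (\<forall>i. \<bar>x $ i\<bar> \<le> R) \<longrightarrow> (\<exists>p\<in>G. norm (x - p) \<le> real d / real (n ^ 3))))" for n :: nat
  proof (cases "1 \<le> n")
    case True
    then have "1 \<le> n ^ 3" by simp
    from box_grid[OF R this] obtain G :: "(real ^ 'd) set" where
      "finite G" "real (card G) \<le> ((2 * R + 3) * real (n ^ 3)) ^ CARD('d)"
      "\<And>x. (\<And>i. \<bar>x $ i\<bar> \<le> R) \<Longrightarrow> \<exists>p\<in>G. norm (x - p) \<le> real CARD('d) / real (n ^ 3)"
      by blast
    then show ?thesis unfolding d_def by (intro exI[of _ G]) blast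
  next
    \<comment> \<open>Only n = 0 is left, where the mesh 1/n^3 makes no sense; any finite set
      serves.\<close>
    case False
    then show ?thesis by (intro exI[of _ "{}"]) auto
  qed
  then obtain G :: "nat \<Rightarrow> (real ^ 'd) set" where G: "\<And>n. finite (G n)"
    "\<And>n. 1 \<le> n \<Longrightarrow> real (card (G n)) \<le> ((2 * R + 3) * real (n ^ 3)) ^ d"
    "\<And>n x. 1 \<le> n \<Longrightarrow> (\<forall>i. \<bar>x $ i\<bar> \<le> R) \<Longrightarrow> \<exists>p\<in>G n. norm (x - p) \<le> real d / real (n ^ 3)"
    by metis
  note bw_ev = bandwidth_eventually[OF bw, folded d_def]
  have grid_AE: "AE \<omega> in M. \<forall>\<^sub>F n in sequentially. \<forall>p\<in>G n.
      \<bar>(\<Sum>l = 1..n. scaled_kernel (h n) (p - fst (Z l \<omega>)) * w n (Z l \<omega>)) / real n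
        - expectation (\<lambda>\<omega>. scaled_kernel (h n) (p - fst (Z0 \<omega>)) * w n (Z0 \<omega>))\<bar> < \<epsilon> / 2"
  proof (rule sample_means_AE[where C = "(2 * R + 3) ^ d" and p = "3 * real d" and m = m'
        and b = "\<lambda>n. W' / h n ^ d" and B = W'])
    show "\<forall>\<^sub>F n in sequentially. real (card (G n)) \<le> (2 * R + 3) ^ d * real n powr (3 * real d)"
      using eventually_ge_at_top[of 1]
    proof eventually_elim
      case (elim n)
      have "((2 * R + 3) * real (n ^ 3)) ^ d = (2 * R + 3) ^ d * real n ^ (3 * d)"
        by (simp add: power_mult_distrib power_mult[symmetric])
      also have "real n ^ (3 * d) = real n powr (3 * real d)"
        using elim powr_realpow[of "real n" "3 * d"] by simp
      finally show ?case using G(2)[OF elim] by simp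
    qed
    show "\<forall>\<^sub>F n in sequentially. \<forall>i\<in>G n. \<forall>z\<in>space (borel \<Otimes>\<^sub>M count_space UNIV).
        0 \<le> scaled_kernel (h n) (i - fst z) * w n z \<and> scaled_kernel (h n) (i - fst z) * w n z \<le> W' / h n ^ d"
      using bw_ev
    proof eventually_elim
      case (elim n)
      have "scaled_kernel (h n) (i - fst z) * w n z \<le> 1 / h n ^ d * W'" for i z
        using elim w[of n z] W' unfolding d_def by (intro mult_mono scaled_kernel_le) auto
      then show ?case using elim w by simp
    qed
    show "\<forall>\<^sub>F n in sequentially. \<forall>i\<in>G n. expectation (\<lambda>\<omega>. scaled_kernel (h n) (i - fst (Z0 \<omega>)) * w n (Z0 \<omega>)) \<le> m'"
      using eventually_ge_at_top[of 1]
    proof eventually_elim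
      case (elim n)
      then show ?case using m[of n] m' unfolding weighted_mean_def by (auto intro: order.trans)
    qed
    show "\<forall>\<^sub>F n in sequentially. 0 < W' / h n ^ d \<and> W' / h n ^ d * (ln (real n))\<^sup>2 \<le> W' * real n"
      using bw_ev
    proof eventually_elim
      case (elim n)
      then have "W' * (ln (real n))\<^sup>2 \<le> W' * (real n * h n ^ d)" using W' by (intro mult_left_mono) auto
      then show ?case using elim W' by (simp add: field_simps)
    qed
  qed (use G e m' W' in auto)
  have ln_ev: "\<forall>\<^sub>F n :: nat in sequentially. 1 \<le> (ln (real n))\<^sup>2" by real_asymp
  have step_ev: "\<forall>\<^sub>F n :: nat in sequentially. W' * real d / real n \<le> \<epsilon> / 4"
    using e by real_asymp
  from grid_AE show ?thesis
  proof eventually_elim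
    case (elim \<omega>)
    then show ?case
      using ln_ev step_ev bw_ev eventually_ge_at_top[of 1]
    proof eventually_elim
      case (elim n)
      have n: "0 < real n" using elim by simp
      have hn: "0 < h n" "h n \<le> 1" using elim by auto
      have "1 \<le> real n * h n ^ d" using elim by linarith
      then have hd: "1 / real n \<le> h n ^ d" using n by (simp add: field_simps)
      also have "h n ^ d \<le> h n ^ 1" using hn d by (intro power_decreasing) auto
      finally have h1: "1 / real n \<le> h n" by simp
      have "1 / real n * (1 / real n) \<le> h n * h n ^ d"
        using h1 hd hn n by (intro mult_mono) auto
      then have hd1: "1 / (real n * real n) \<le> h n ^ (d + 1)" by simp
      have lip: "W * (norm (x - p) / h n ^ (d + 1)) \<le> \<epsilon> / 4" if "norm (x - p) \<le> real d / real (n ^ 3)" for x p :: "real ^ 'd"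
      proof -
        have "norm (x - p) / h n ^ (d + 1) \<le> (real d / real (n ^ 3)) / (1 / (real n * real n))"
          using that hd1 n hn by (intro frac_le) auto
        also have "\<dots> = real d / real n" using n by (simp add: power3_eq_cube)
        finally have "W * (norm (x - p) / h n ^ (d + 1)) \<le> W' * (real d / real n)"
          using W' hn by (intro mult_mono) auto
        also have "\<dots> \<le> \<epsilon> / 4" using elim by simp
        finally show ?thesis .
      qed
      show ?case
      proof (intro allI impI)
        \<comment> \<open>The deviation on the grid takes \<epsilon>/2; the two Lipschitz steps, for
          the estimate and for its mean, take \<epsilon>/4 each.\<close>
        fix x :: "real ^ 'd" assume "\<forall>i. \<bar>x $ i\<bar> \<le> R"
        then obtain p where p: "p \<in> G n" "norm (x - p) \<le> real d / real (n ^ 3)"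
          using G(3) elim by blast
        have 1: "\<bar>weighted_kde n (h n) (\<lambda>l. Z l \<omega>) (w n) p - weighted_mean (h n) (w n) p\<bar> < \<epsilon> / 2"
          using elim p(1) by (simp add: weighted_kde_def weighted_mean_def)
        have 2: "\<bar>weighted_kde n (h n) (\<lambda>l. Z l \<omega>) (w n) x - weighted_kde n (h n) (\<lambda>l. Z l \<omega>) (w n) p\<bar> \<le> \<epsilon> / 4"
          using weighted_kde_lipschitz[of "h n" "w n" W n "\<lambda>l. Z l \<omega>" x p, OF hn(1) w] lip[OF p(2)] elim
          unfolding d_def by linarith
        have 3: "\<bar>weighted_mean (h n) (w n) x - weighted_mean (h n) (w n) p\<bar> \<le> \<epsilon> / 4"
          using weighted_mean_lipschitz[OF hn(1) w w_meas, of n x p] lip[OF p(2)]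
          unfolding d_def by linarith
        from 1 2 3 show "\<bar>weighted_kde n (h n) (\<lambda>l. Z l \<omega>) (w n) x - weighted_mean (h n) (w n) x\<bar> \<le> \<epsilon>"
          by linarith
      qed
    qed
  qed
qed

end

section \<open>Similarity sums and regret for a fixed sample\<close>

lemma kde_eq_weighted_kde: "kde n h xs x = weighted_kde n h (\<lambda>l. (xs l, ys l)) (\<lambda>_. 1) x"
  by (simp add: kde_def weighted_kde_def)

lemma kde_pos: "1 \<le> n \<Longrightarrow> 0 < h \<Longrightarrow> 0 < kde n h xs x"
  by (auto simp: kde_def intro!: divide_pos_pos sum_pos scaled_kernel_pos)

lemma eta_hat_eq:
  "1 \<le> n \<Longrightarrow> eta_hat n h xs ys i x
    = weighted_kde n h (\<lambda>l. (xs l, ys l)) (\<lambda>z. of_bool (snd z = i)) x / kde n h xs x"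
  by (simp add: eta_hat_def weighted_kde_def)

lemma G_sim_nonneg: "1 \<le> n \<Longrightarrow> 0 < h \<Longrightarrow> 0 \<le> G_sim n h xs x y"
  using kde_pos[of n h xs x] kde_pos[of n h xs y] by (simp add: G_sim_def)

text \<open>All \<open>eta_hat\<close> share the positive denominator \<open>kde\<close>, so a
  maximiser of them also maximises the numerators.\<close>

lemma plugin_classifier_maximises:
  assumes F: "plugin_classifier Q n h xs ys F" and n: "1 \<le> n" and h: "0 < h" and i: "i \<in> {1..Q}"
  shows "weighted_kde n h (\<lambda>l. (xs l, ys l)) (\<lambda>z. of_bool (snd z = i)) x
    \<le> weighted_kde n h (\<lambda>l. (xs l, ys l)) (\<lambda>z. of_bool (snd z = F x)) x"
proof -
  have "eta_hat n h xs ys i x \<le> eta_hat n h xs ys (F x) x"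
    using F i by (auto simp: plugin_classifier_def is_arg_max_def not_less)
  then show ?thesis
    using kde_pos[OF n h, of xs x] by (simp add: eta_hat_eq[OF n] divide_le_cancel)
qed

text \<open>An unobserved label has estimate 0, whereas the Gaussian kernel is positive everywhere,
  so the label of the first sample point has a positive estimate at every x.\<close>

lemma plugin_classifier_observed_label:
  assumes F: "plugin_classifier Q n h xs ys F" and n: "1 \<le> n" and h: "0 < h"
    and ys: "\<And>l. l \<in> {1..n} \<Longrightarrow> ys l \<in> J" and J: "J \<subseteq> {1..Q}"
  shows "F x \<in> J"
proof (rule ccontr)
  assume "F x \<notin> J"
  then have "ys l \<noteq> F x" if "l \<in> {1..n}" for l using ys[OF that] by auto
  then have "weighted_kde n h (\<lambda>l. (xs l, ys l)) (\<lambda>z. of_bool (snd z = F x)) x = 0"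
    by (auto simp: weighted_kde_def intro!: sum.neutral)
  moreover have "0 < weighted_kde n h (\<lambda>l. (xs l, ys l)) (\<lambda>z. of_bool (snd z = ys 1)) x"
    unfolding weighted_kde_def using n h
    by (intro divide_pos_pos sum_pos2[of _ 1]) (auto simp: scaled_kernel_pos)
  ultimately show False
    using plugin_classifier_maximises[OF F n h, of "ys 1" x] ys[of 1] J n by auto
qed

text \<open>Since \<open>v\<close> dominates \<open>kde\<close> at the sample points,
  \<open>G_sim\<close> is at least the kernel times the weights \<rho> at both points. The sum over
  \<open>m\<close> becomes a weighted kernel estimate, which is \<open>q\<close> up to \<epsilon>;
  multiplied by \<rho> \<le> r this costs \<epsilon> r, and replacing the average over
  \<open>l\<close> by \<open>I\<close> costs another \<epsilon>.\<close>

lemma similarity_sum_ge: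
  fixes xs :: "nat \<Rightarrow> real ^ 'd" and q :: "nat \<Rightarrow> real ^ 'd \<Rightarrow> real"
  assumes n: "1 \<le> n" and h: "0 < h"
    and v: "\<And>l. l \<in> {1..n} \<Longrightarrow> kde n h xs (xs l) \<le> v (xs l)"
    and \<rho>: "\<And>x. \<rho> x = 1 / sqrt (v x)" and \<rho>_le: "\<And>x. \<rho> x \<le> r"
    and q: "\<And>l. l \<in> {1..n} \<Longrightarrow> \<bar>weighted_kde n h (\<lambda>l. (xs l, ys l))
        (\<lambda>z. of_bool (snd z \<noteq> ys l) * \<rho> (fst z)) (xs l) - q (ys l) (xs l)\<bar> \<le> \<epsilon>"
    and I: "\<bar>(\<Sum>l = 1..n. \<rho> (xs l) * q (ys l) (xs l)) / n - I\<bar> \<le> \<epsilon>"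
  shows "I - \<epsilon> - \<epsilon> * r \<le> (\<Sum>l = 1..n. \<Sum>m = 1..n. theta (ys l) (ys m) * G_sim n h xs (xs l) (xs m)) / (real n)\<^sup>2"
proof -
  have n0: "0 < real n" using n by simp
  have e: "0 \<le> \<epsilon>" using q[of 1] n by (force intro: order.trans[OF abs_ge_zero])
  have vpos: "0 < v (xs l)" if "l \<in> {1..n}" for l
    using v[OF that] kde_pos[OF n h] by (rule less_le_trans[rotated])
  have \<rho>pos: "0 \<le> \<rho> (xs l)" if "l \<in> {1..n}" for l
    using vpos[OF that] by (simp add: \<rho>)
  have G_ge: "scaled_kernel h (xs l - xs m) * \<rho> (xs m) * \<rho> (xs l) \<le> G_sim n h xs (xs l) (xs m)"
    if l: "l \<in> {1..n}" and m: "m \<in> {1..n}" for l m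
  proof -
    have "sqrt (kde n h xs (xs l)) * sqrt (kde n h xs (xs m)) \<le> sqrt (v (xs l)) * sqrt (v (xs m))"
      using v[OF l] v[OF m] vpos[OF l] kde_pos[OF n h, of xs "xs m"] by (intro mult_mono) auto
    then have "scaled_kernel h (xs l - xs m) / (sqrt (v (xs l)) * sqrt (v (xs m))) \<le> G_sim n h xs (xs l) (xs m)"
      unfolding G_sim_def using kde_pos[OF n h] vpos l m h
      by (intro divide_left_mono) (auto intro!: mult_pos_pos)
    then show ?thesis by (simp add: \<rho> mult_ac)
  qed
  have row: "real n * (\<rho> (xs l) * q (ys l) (xs l) - \<epsilon> * r) \<le> (\<Sum>m = 1..n. theta (ys l) (ys m) * G_sim n h xs (xs l) (xs m))"
    if l: "l \<in> {1..n}" for l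
  proof -
    let ?w = "weighted_kde n h (\<lambda>l. (xs l, ys l)) (\<lambda>z. of_bool (snd z \<noteq> ys l) * \<rho> (fst z)) (xs l)"
    have "\<rho> (xs l) * (q (ys l) (xs l) - \<epsilon>) \<le> \<rho> (xs l) * ?w"
      using q[OF l] \<rho>pos[OF l] by (intro mult_left_mono) auto
    moreover have "\<rho> (xs l) * \<epsilon> \<le> r * \<epsilon>" using \<rho>_le e by (intro mult_right_mono) auto
    ultimately have "real n * (\<rho> (xs l) * q (ys l) (xs l) - \<epsilon> * r) \<le> real n * (\<rho> (xs l) * ?w)"
      by (intro mult_left_mono) (auto simp: algebra_simps)
    also have "\<dots> = \<rho> (xs l) * (\<Sum>m = 1..n. scaled_kernel h (xs l - xs m) * (of_bool (ys m \<noteq> ys l) * \<rho> (xs m)))"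
      using n0 by (simp add: weighted_kde_def)
    \<comment> \<open>The label condition removes the term m = l, so the large value of the kernel
      at 0 never enters.\<close>
    also have "\<dots> = (\<Sum>m = 1..n. theta (ys l) (ys m) * (scaled_kernel h (xs l - xs m) * \<rho> (xs m) * \<rho> (xs l)))"
      by (simp add: sum_distrib_left theta_def mult_ac eq_commute[of "ys l"])
    also have "\<dots> \<le> (\<Sum>m = 1..n. theta (ys l) (ys m) * G_sim n h xs (xs l) (xs m))"
      using G_ge[OF l] by (intro sum_mono mult_left_mono) (auto simp: theta_def)
    finally show ?thesis .
  qed
  have "real n * real n * ((\<Sum>l = 1..n. \<rho> (xs l) * q (ys l) (xs l)) / n - \<epsilon> * r)
      = (\<Sum>l = 1..n. real n * (\<rho> (xs l) * q (ys l) (xs l) - \<epsilon> * r))"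
    using n0 by (simp add: sum_distrib_left[symmetric] sum_subtractf algebra_simps)
  also have "\<dots> \<le> (\<Sum>l = 1..n. \<Sum>m = 1..n. theta (ys l) (ys m) * G_sim n h xs (xs l) (xs m))"
    by (intro sum_mono row)
  finally have "(\<Sum>l = 1..n. \<rho> (xs l) * q (ys l) (xs l)) / n - \<epsilon> * r
      \<le> (\<Sum>l = 1..n. \<Sum>m = 1..n. theta (ys l) (ys m) * G_sim n h xs (xs l) (xs m)) / (real n)\<^sup>2"
    using n0 by (simp add: pos_le_divide_eq power2_eq_square mult.commute)
  with I show ?thesis by linarith
qed

text \<open>Approximate maximality gives g i - 2e \<le> g j for every i. Averaging with the weights
  g i / sum g J bounds g j from below by the sum of the squares divided by the total, less 2e: a
  maximum is at least a weighted mean.\<close>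

lemma pointwise_regret:
  fixes g g' :: "'i \<Rightarrow> real"
  assumes J: "finite J" "j \<in> J" and g: "\<And>i. i \<in> J \<Longrightarrow> 0 \<le> g i"
    and e: "\<And>i. i \<in> J \<Longrightarrow> \<bar>g' i - g i\<bar> \<le> e" and max: "\<And>i. i \<in> J \<Longrightarrow> g' i \<le> g' j"
  shows "sum g J - g j \<le> (\<Sum>i\<in>J. g i * (sum g J - g i) / sum g J) + 2 * e"
proof (cases "sum g J = 0")
  case True
  then have "g j = 0" using J g by (simp add: sum_nonneg_eq_0_iff)
  moreover have "0 \<le> e" using e[OF J(2)] by linarith
  ultimately show ?thesis using True by simp
next
  case False
  then have f: "0 < sum g J" using g by (simp add: sum_nonneg less_le)
  have "g i - 2 * e \<le> g j" if "i \<in> J" for i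
    using e[OF that] e[OF J(2)] max[OF that] by linarith
  then have "(\<Sum>i\<in>J. g i * (g i - 2 * e)) \<le> (\<Sum>i\<in>J. g i * g j)"
    using g by (intro sum_mono mult_left_mono) auto
  also have "\<dots> = sum g J * g j" by (simp add: sum_distrib_right)
  also have "(\<Sum>i\<in>J. g i * (g i - 2 * e)) = (\<Sum>i\<in>J. g i * g i) - 2 * e * sum g J"
    by (simp add: right_diff_distrib sum_subtractf flip: sum_distrib_right)
  finally have "(\<Sum>i\<in>J. g i * g i) - 2 * e * sum g J \<le> sum g J * g j" .
  then have "(\<Sum>i\<in>J. g i * g i) / sum g J - 2 * e \<le> g j"
    using f by (simp add: field_simps)
  moreover have "(\<Sum>i\<in>J. g i * (sum g J - g i) / sum g J) = sum g J - (\<Sum>i\<in>J. g i * g i) / sum g J"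
    using f by (simp add: right_diff_distrib sum_subtractf diff_divide_distrib
        sum_divide_distrib[symmetric] sum_distrib_right[symmetric])
  ultimately show ?thesis by linarith
qed

text \<open>With a and b the two roots, 1/a - 1/b = (b^2 - a^2) / (a b (a + b)), and the shift keeps
  the denominator above \<delta>^(3/2).\<close>

lemma inverse_sqrt_lipschitz:
  fixes s t \<delta> :: real
  assumes \<delta>: "0 < \<delta>" and st: "0 \<le> s" "0 \<le> t"
  shows "\<bar>1 / sqrt (s + \<delta>) - 1 / sqrt (t + \<delta>)\<bar> \<le> \<bar>s - t\<bar> / (\<delta> * sqrt \<delta>)"
proof -
  define a b where "a = sqrt (s + \<delta>)" and "b = sqrt (t + \<delta>)"
  have ab: "sqrt \<delta> \<le> a" "sqrt \<delta> \<le> b" using \<delta> st by (auto simp: a_def b_def)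
  have d0: "0 < sqrt \<delta>" using \<delta> by simp
  have pos: "0 < a" "0 < b" using ab d0 by linarith+
  have "a\<^sup>2 = s + \<delta>" "b\<^sup>2 = t + \<delta>" using \<delta> st by (auto simp: a_def b_def)
  then have "t - s = (b - a) * (a + b)" by (simp add: power2_eq_square algebra_simps)
  then have "(t - s) / (a * b * (a + b)) = (b - a) / (a * b)"
    using pos by simp
  then have "1 / a - 1 / b = (t - s) / (a * b * (a + b))"
    using pos by (simp add: diff_divide_distrib)
  then have "\<bar>1 / a - 1 / b\<bar> = \<bar>s - t\<bar> / (a * b * (a + b))"
    using pos by (simp add: abs_divide abs_mult abs_minus_commute)
  also have "\<dots> \<le> \<bar>s - t\<bar> / (sqrt \<delta> * sqrt \<delta> * sqrt \<delta>)"
  proof (rule divide_left_mono)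
    show "sqrt \<delta> * sqrt \<delta> * sqrt \<delta> \<le> a * b * (a + b)"
      using ab d0 pos by (intro mult_mono) auto
  qed (use pos d0 in auto)
  finally show ?thesis using \<delta> by (simp add: a_def b_def)
qed

section \<open>The limiting densities\<close>

text \<open>Holding almost surely depends only on the law, which the sample points share with
  \<open>Z0\<close>, and there are countably many of them.\<close>

lemma (in iid_sample) AE_sample:
  assumes P: "{z \<in> space N. P z} \<in> sets N" and AE0: "AE \<omega> in M. P (Z0 \<omega>)"
  shows "AE \<omega> in M. \<forall>l\<ge>1. P (Z l \<omega>)"
proof -
  have "AE \<omega> in M. P (Z l \<omega>)" if "l \<ge> 1" for l
  proof -
    have "AE z in distr M N (Z l). P z"
      unfolding ident[OF that] AE_distr_iff[OF Z0 P] by (rule AE0)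
    then show ?thesis unfolding AE_distr_iff[OF Z_measurable[OF that] P] .
  qed
  then show ?thesis by (simp add: AE_all_countable)
qed

text \<open>Here \<open>g i\<close> stands for class probability times class density, cut off to the
  bounded Borel set \<open>A\<close>. The joint law enters through the integration formula
  \<open>law\<close> for bounded test functions, which yields the means of the estimates, the
  misclassification error and the total mass 1 of the \<open>g i\<close>.\<close>

locale label_densities = labelled_sample M Z0 Z
  for M :: "'w measure" and Z0 :: "'w \<Rightarrow> (real ^ 'd) \<times> nat" and Z :: "nat \<Rightarrow> 'w \<Rightarrow> (real ^ 'd) \<times> nat" +
  fixes J :: "nat set" and A :: "(real ^ 'd) set" and g :: "nat \<Rightarrow> real ^ 'd \<Rightarrow> real" and B R :: real
  assumes J: "finite J"
    and A [measurable]: "A \<in> sets borel" and A_box: "\<And>x i. x \<in> A \<Longrightarrow> \<bar>x $ i\<bar> \<le> R" and R: "0 \<le> R"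
    and g_meas [measurable]: "\<And>i. g i \<in> borel_measurable borel"
    and g_nonneg: "\<And>i x. 0 \<le> g i x" and g_le: "\<And>i x. g i x \<le> B"
    and g_off: "\<And>i x. x \<notin> A \<Longrightarrow> g i x = 0" and g_label: "\<And>i x. i \<notin> J \<Longrightarrow> g i x = 0"
    and law: "\<And>\<phi> b. \<phi> \<in> borel_measurable (borel \<Otimes>\<^sub>M count_space UNIV) \<Longrightarrow> (\<And>z. \<bar>\<phi> z\<bar> \<le> b) \<Longrightarrow>
      expectation (\<lambda>\<omega>. \<phi> (Z0 \<omega>)) = (\<Sum>i\<in>J. \<integral>x. \<phi> (x, i) * g i x \<partial>lborel)"
begin

text \<open>Defined from the \<open>g i\<close>, so that the decomposition of the marginal density
  holds at every point and not just almost everywhere.\<close>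

definition f :: "real ^ 'd \<Rightarrow> real" where
  "f x = (\<Sum>i\<in>J. g i x)"

lemma f_meas [measurable]: "f \<in> borel_measurable borel"
  unfolding f_def[abs_def] by measurable

lemma f_nonneg: "0 \<le> f x" and f_le: "f x \<le> card J * B" and f_off: "x \<notin> A \<Longrightarrow> f x = 0"
  using g_nonneg g_le sum_bounded_above[of J "\<lambda>i. g i x" B] by (auto simp: f_def sum_nonneg g_off)

lemma g_le_f: "g i x \<le> f x"
proof (cases "i \<in> J")
  case True
  then show ?thesis unfolding f_def by (rule member_le_sum) (use J g_nonneg in auto)
qed (simp add: g_label f_nonneg)

lemma A_finite: "emeasure lborel A < \<infinity>"
proof (rule emeasure_bounded_finite)
  have "A \<subseteq> cbox (\<chi> i. - R) (\<chi> i. R)"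
    using A_box by (auto simp: mem_box_cart abs_le_iff minus_le_iff)
  then show "bounded A" by (rule bounded_subset[OF bounded_cbox])
qed

lemma integrable_on_A:
  assumes [measurable]: "r \<in> borel_measurable borel" and r: "\<And>x. \<bar>r x\<bar> \<le> b" "\<And>x. x \<notin> A \<Longrightarrow> r x = (0 :: real)"
  shows "integrable lborel r"
proof (rule Bochner_Integration.integrable_bound[of _ "\<lambda>x. b * indicator A x"])
  show "integrable lborel (\<lambda>x. b * indicator A x :: real)"
    using A_finite by (simp add: integrable_indicator_iff)
  show "AE x in lborel. norm (r x) \<le> norm (b * indicator A x :: real)"
    using r by (intro AE_I2) (auto split: split_indicator intro: order.trans[OF _ abs_ge_self])
qed measurable

lemma g_int: "integrable lborel (g i)"
  by (rule integrable_on_A[where b = B]) (use g_nonneg g_le g_off in auto)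

lemma f_int: "integrable lborel f"
  by (rule integrable_on_A[where b = "card J * B"]) (use f_nonneg f_le f_off in auto)

lemma sum_integral_g: "(\<Sum>i\<in>J. \<integral>x. g i x \<partial>lborel) = 1"
  using law[of "\<lambda>_. 1" 1] by (simp add: prob_space)

lemma weighted_mean_eq:
  assumes h: "0 < h" and [measurable]: "w \<in> borel_measurable (borel \<Otimes>\<^sub>M count_space UNIV)"
    and w: "\<And>z. \<bar>w z\<bar> \<le> W"
  shows "weighted_mean h w x = (\<Sum>i\<in>J. smooth h (\<lambda>y. w (y, i) * g i y) x)"
proof -
  have "weighted_mean h w x = (\<Sum>i\<in>J. \<integral>y. (scaled_kernel h (x - fst (y, i)) * w (y, i)) * g i y \<partial>lborel)"
    unfolding weighted_mean_def
  proof (rule law[where b = "1 / h ^ CARD('d) * W" and \<phi> = "\<lambda>z. scaled_kernel h (x - fst z) * w z"])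
    show "\<bar>scaled_kernel h (x - fst z) * w z\<bar> \<le> 1 / h ^ CARD('d) * W" for z
      unfolding abs_mult using h w scaled_kernel_le[OF h] by (intro mult_mono) auto
  qed measurable
  then show ?thesis by (simp add: smooth_def mult.assoc)
qed

lemma weighted_g_int:
  assumes [measurable]: "w \<in> borel_measurable borel" and w: "\<And>x. \<bar>w x\<bar> \<le> W"
  shows "integrable lborel (\<lambda>x. w x * g i x)"
proof (rule integrable_on_A[where b = "W * B"])
  show "\<bar>w x * g i x\<bar> \<le> W * B" for x
    unfolding abs_mult using w g_nonneg g_le order.trans[OF abs_ge_zero w] by (intro mult_mono) auto
qed (auto simp: g_off)

lemma weighted_mean_le:
  assumes h: "0 < h" and w_meas: "w \<in> borel_measurable (borel \<Otimes>\<^sub>M count_space UNIV)"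
    and w: "\<And>z. \<bar>w z\<bar> \<le> W"
  shows "weighted_mean h w x \<le> card J * (W * B)"
proof -
  have w_meas' [measurable]: "(\<lambda>y. w (y, i)) \<in> borel_measurable borel" for i
    by (rule measurable_compose[OF _ w_meas]) simp
  have "smooth h (\<lambda>y. w (y, i) * g i y) x \<le> W * B" for i
  proof -
    have "\<bar>w (y, i) * g i y\<bar> \<le> W * B" for y
      unfolding abs_mult using w g_nonneg g_le order.trans[OF abs_ge_zero w] by (intro mult_mono) auto
    then have "\<bar>smooth h (\<lambda>y. w (y, i) * g i y) x\<bar> \<le> W * B"
      by (intro smooth_abs_le[OF h] weighted_g_int[OF w_meas' w])
    then show ?thesis by simp
  qed
  then show ?thesis
    unfolding weighted_mean_eq[OF assms] by (rule sum_bounded_above)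
qed

lemma smooth_f_nonneg: "0 < h \<Longrightarrow> 0 \<le> smooth h f x"
  by (rule smooth_nonneg) (auto simp: f_nonneg)

lemma weighted_mean_1: "0 < h \<Longrightarrow> weighted_mean h (\<lambda>_. 1) x = smooth h f x"
  unfolding f_def[abs_def]
  by (subst weighted_mean_eq[where W = 1])
     (auto simp: smooth_def sum_distrib_left integrable_scaled_kernel_mult g_int)

lemma weighted_mean_label:
  assumes "0 < h" "i \<in> J"
  shows "weighted_mean h (\<lambda>z. of_bool (snd z = i)) x = smooth h (g i) x"
proof -
  have "(\<Sum>j\<in>J. smooth h (\<lambda>y. of_bool (snd (y, j) = i) * g j y) x) = (\<Sum>j\<in>J. if j = i then smooth h (g i) x else 0)"
    by (intro sum.cong) (auto simp: smooth_def)
  then show ?thesis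
    using assms J by (subst weighted_mean_eq[where W = 1]) auto
qed

text \<open>The inner similarity sum for a point with label \<open>i\<close> sees only the other
  labels, whose joint density is f - g i.\<close>

lemma weighted_mean_other_labels:
  assumes h: "0 < h" and i: "i \<in> J" and [measurable]: "\<rho> \<in> borel_measurable borel"
    and \<rho>: "\<And>x. \<bar>\<rho> x\<bar> \<le> r"
  shows "weighted_mean h (\<lambda>z. of_bool (snd z \<noteq> i) * \<rho> (fst z)) x = smooth h (\<lambda>y. \<rho> y * (f y - g i y)) x"
proof -
  have bnd: "\<bar>of_bool (snd z \<noteq> i) * \<rho> (fst z)\<bar> \<le> r" for z :: "(real ^ 'd) \<times> nat"
    using \<rho>[of "fst z"] by (auto simp: of_bool_def)
  have "weighted_mean h (\<lambda>z. of_bool (snd z \<noteq> i) * \<rho> (fst z)) x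
      = (\<Sum>j\<in>J. smooth h (\<lambda>y. of_bool (j \<noteq> i) * \<rho> y * g j y) x)"
    using bnd by (subst weighted_mean_eq[OF h _ bnd]) auto
  also have "\<dots> = smooth h (\<lambda>y. \<Sum>j\<in>J. of_bool (j \<noteq> i) * \<rho> y * g j y) x"
  proof -
    have "integrable lborel (\<lambda>y. of_bool (j \<noteq> i) * \<rho> y * g j y)" for j
      using \<rho> by (intro weighted_g_int[where W = r]) (auto simp: of_bool_def intro: order.trans[OF abs_ge_zero])
    then show ?thesis
      using h by (simp add: smooth_def sum_distrib_left integrable_scaled_kernel_mult)
  qed
  also have "(\<lambda>y. \<Sum>j\<in>J. of_bool (j \<noteq> i) * \<rho> y * g j y) = (\<lambda>y. \<rho> y * (f y - g i y))"
  proof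
    fix y
    have "(\<Sum>j\<in>J. of_bool (j \<noteq> i) * \<rho> y * g j y) = (\<Sum>j\<in>J - {i}. \<rho> y * g j y)"
      using J i by (subst sum.remove[OF J i]) (auto intro!: sum.cong)
    also have "\<dots> = \<rho> y * (f y - g i y)"
      using sum.remove[OF J i, of "\<lambda>j. g j y"] by (simp add: f_def sum_distrib_left[symmetric])
    finally show "(\<Sum>j\<in>J. of_bool (j \<noteq> i) * \<rho> y * g j y) = \<rho> y * (f y - g i y)" .
  qed
  finally show ?thesis .
qed

text \<open>The error of the randomised rule that draws the label with probabilities
  \<open>\<eta>\<^sub>i = g\<^sub>i / f\<close> (with \<open>0/0 = 0\<close> off the support).\<close>

definition gini :: real where
  "gini = (\<Sum>i\<in>J. \<integral>x. g i x * (f x - g i x) / f x \<partial>lborel)"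

lemma gini_summand: "0 \<le> g i x * (f x - g i x) / f x" "g i x * (f x - g i x) / f x \<le> g i x"
proof -
  show "0 \<le> g i x * (f x - g i x) / f x"
    using g_nonneg g_le_f f_nonneg by (intro divide_nonneg_nonneg mult_nonneg_nonneg) auto
  show "g i x * (f x - g i x) / f x \<le> g i x"
  proof (cases "f x = 0")
    case False
    then have "0 < f x" using f_nonneg[of x] by simp
    moreover have "g i x * (f x - g i x) \<le> g i x * f x"
      using g_nonneg by (intro mult_left_mono) auto
    ultimately show ?thesis by (simp add: field_simps)
  qed (use g_nonneg in simp)
qed

lemma gini_summand_int: "integrable lborel (\<lambda>x. g i x * (f x - g i x) / f x)"
proof (rule integrable_on_A[where b = B])
  show "\<bar>g i x * (f x - g i x) / f x\<bar> \<le> B" for x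
    using gini_summand[of i x] g_le[of i x] by simp
qed (auto simp: g_off)

section \<open>The risk of approximate maximisers\<close>

lemma misclassification_error_eq:
  assumes F [measurable]: "F \<in> measurable borel (count_space UNIV)" and FJ: "\<And>x. F x \<in> J"
  shows "misclassification_error M (\<lambda>\<omega>. fst (Z0 \<omega>)) (\<lambda>\<omega>. snd (Z0 \<omega>)) F = (\<integral>x. f x - g (F x) x \<partial>lborel)"
proof -
  have [measurable]: "(\<lambda>z. of_bool (F (fst z) \<noteq> snd z) :: real) \<in> borel_measurable (borel \<Otimes>\<^sub>M count_space UNIV)"
    by (rule measurable_compose_countable[of "\<lambda>i z. of_bool (F (fst z) \<noteq> i)" _ _ snd]) measurable
  have "misclassification_error M (\<lambda>\<omega>. fst (Z0 \<omega>)) (\<lambda>\<omega>. snd (Z0 \<omega>)) F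
      = expectation (indicator {\<omega> \<in> space M. F (fst (Z0 \<omega>)) \<noteq> snd (Z0 \<omega>)})"
    unfolding misclassification_error_def by (subst Bochner_Integration.integral_indicator) (auto intro!: arg_cong[where f = "measure M"])
  also have "\<dots> = expectation (\<lambda>\<omega>. of_bool (F (fst (Z0 \<omega>)) \<noteq> snd (Z0 \<omega>)))"
    by (intro Bochner_Integration.integral_cong) (auto simp: indicator_def)
  also have "\<dots> = (\<Sum>i\<in>J. \<integral>x. of_bool (F (fst (x, i)) \<noteq> snd (x, i)) * g i x \<partial>lborel)"
    by (rule law[where b = 1 and \<phi> = "\<lambda>z. of_bool (F (fst z) \<noteq> snd z)"]) auto
  also have "\<dots> = (\<integral>x. (\<Sum>i\<in>J. of_bool (F x \<noteq> i) * g i x) \<partial>lborel)"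
    by (subst Bochner_Integration.integral_sum) (auto intro!: weighted_g_int[where W = 1])
  also have "\<dots> = (\<integral>x. f x - g (F x) x \<partial>lborel)"
  proof (rule Bochner_Integration.integral_cong)
    fix x
    have "(\<Sum>i\<in>J. of_bool (F x \<noteq> i) * g i x) = (\<Sum>i\<in>J - {F x}. g i x)"
      using J FJ by (subst sum.remove[OF J FJ[of x]]) (auto intro!: sum.cong)
    then show "(\<Sum>i\<in>J. of_bool (F x \<noteq> i) * g i x) = f x - g (F x) x"
      using sum.remove[OF J FJ[of x], of "\<lambda>j. g j x"] by (simp add: f_def)
  qed simp
  finally show ?thesis .
qed

text \<open>The pointwise regret is integrated, with \<open>g'\<close> the estimates and
  \<open>u\<close> their means. The uniform deviation \<epsilon> costs a multiple of the measure of
  \<open>A\<close>, while the bias is charged in L^1 only and may be large near the boundary of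
  \<open>A\<close>.\<close>

lemma misclassification_error_le:
  assumes F [measurable]: "F \<in> measurable borel (count_space UNIV)" and FJ: "\<And>x. F x \<in> J"
    and u: "\<And>i. i \<in> J \<Longrightarrow> integrable lborel (u i)"
    and est: "\<And>i x. i \<in> J \<Longrightarrow> x \<in> A \<Longrightarrow> \<bar>g' i x - u i x\<bar> \<le> \<epsilon>"
    and max: "\<And>i x. i \<in> J \<Longrightarrow> g' i x \<le> g' (F x) x"
  shows "misclassification_error M (\<lambda>\<omega>. fst (Z0 \<omega>)) (\<lambda>\<omega>. snd (Z0 \<omega>)) F
    \<le> gini + 2 * \<epsilon> * measure lborel A + 2 * (\<Sum>i\<in>J. \<integral>x. \<bar>u i x - g i x\<bar> \<partial>lborel)"
proof -
  let ?E = "\<lambda>x. (\<Sum>i\<in>J. g i x * (f x - g i x) / f x) + 2 * \<epsilon> * indicator A x + 2 * (\<Sum>i\<in>J. \<bar>u i x - g i x\<bar>)"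
  have [measurable]: "(\<lambda>x. g (F x) x) \<in> borel_measurable borel"
    by (rule measurable_compose_countable[OF g_meas F])
  have int1: "integrable lborel (\<lambda>x. f x - g (F x) x)"
  proof (rule integrable_on_A[where b = "card J * B"])
    show "\<bar>f x - g (F x) x\<bar> \<le> card J * B" for x
      using g_nonneg[of "F x" x] g_le_f[of "F x" x] f_le[of x] by linarith
  qed (auto simp: f_off g_off)
  have int2: "integrable lborel ?E"
    using gini_summand_int u g_int A_finite by (auto simp: integrable_indicator_iff)
  have pt: "f x - g (F x) x \<le> ?E x" for x
  proof (cases "x \<in> A")
    case True
    have "f x - g (F x) x \<le> (\<Sum>i\<in>J. g i x * (f x - g i x) / f x) + 2 * (\<epsilon> + (\<Sum>i\<in>J. \<bar>u i x - g i x\<bar>))"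
      unfolding f_def
    proof (rule pointwise_regret[OF J FJ])
      show "\<bar>g' i x - g i x\<bar> \<le> \<epsilon> + (\<Sum>i\<in>J. \<bar>u i x - g i x\<bar>)" if "i \<in> J" for i
      proof -
        have "\<bar>u i x - g i x\<bar> \<le> (\<Sum>i\<in>J. \<bar>u i x - g i x\<bar>)"
          using member_le_sum[of i J "\<lambda>i. \<bar>u i x - g i x\<bar>"] that J by simp
        with est[OF that True] show ?thesis by linarith
      qed
    qed (use g_nonneg max in auto)
    then show ?thesis using True by simp
  next
    case False
    then show ?thesis by (auto simp: f_off g_off intro!: sum_nonneg)
  qed
  have "misclassification_error M (\<lambda>\<omega>. fst (Z0 \<omega>)) (\<lambda>\<omega>. snd (Z0 \<omega>)) F = (\<integral>x. f x - g (F x) x \<partial>lborel)"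
    by (rule misclassification_error_eq[OF F FJ])
  also have "\<dots> \<le> (\<integral>x. ?E x \<partial>lborel)"
    by (rule integral_mono[OF int1 int2 pt])
  also have "\<dots> = gini + 2 * \<epsilon> * measure lborel A + 2 * (\<Sum>i\<in>J. \<integral>x. \<bar>u i x - g i x\<bar> \<partial>lborel)"
    using gini_summand_int u g_int A_finite
    by (simp add: gini_def integrable_indicator_iff)
  finally show ?thesis .
qed

end

section \<open>Almost sure comparison of the risk with the similarity sum\<close>

context label_densities
begin

text \<open>Adding \<delta> makes the inverse square root Lipschitz on the nonnegative numbers, so
  L^1 convergence of the smoothed density passes to the weights.\<close>

lemma regularised_weight_tendsto:
  assumes h: "\<forall>\<^sub>F n in sequentially. 0 < h n" "h \<longlonglongrightarrow> 0" and \<delta>: "0 < \<delta>"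
    and [measurable]: "r \<in> borel_measurable borel" and r: "\<And>x. \<bar>r x\<bar> \<le> b" "\<And>x. x \<notin> A \<Longrightarrow> r x = 0"
  shows "(\<lambda>n. \<integral>x. \<bar>r x * (1 / sqrt (\<bar>smooth (h n) f x\<bar> + \<delta>)) - r x * (1 / sqrt (f x + \<delta>))\<bar> \<partial>lborel) \<longlonglongrightarrow> 0"
proof (rule tendsto_sandwich[OF _ _ tendsto_const])
  let ?L = "b / (\<delta> * sqrt \<delta>)"
  let ?D = "\<lambda>n x. r x * (1 / sqrt (\<bar>smooth (h n) f x\<bar> + \<delta>)) - r x * (1 / sqrt (f x + \<delta>))"
  have b: "0 \<le> b" using r(1)[of undefined] by linarith
  show "\<forall>\<^sub>F n in sequentially. 0 \<le> (\<integral>x. \<bar>?D n x\<bar> \<partial>lborel)" by simp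
  show "(\<lambda>n. ?L * (\<integral>x. \<bar>smooth (h n) f x - f x\<bar> \<partial>lborel)) \<longlonglongrightarrow> 0"
    using tendsto_mult_left[OF smooth_L1_tendsto[OF h f_int], of ?L] by simp
  show "\<forall>\<^sub>F n in sequentially. (\<integral>x. \<bar>?D n x\<bar> \<partial>lborel) \<le> ?L * (\<integral>x. \<bar>smooth (h n) f x - f x\<bar> \<partial>lborel)"
    using h(1)
  proof eventually_elim
    case (elim n)
    have pt: "\<bar>?D n x\<bar> \<le> ?L * \<bar>smooth (h n) f x - f x\<bar>" for x
    proof -
      have "\<bar>?D n x\<bar> = \<bar>r x\<bar> * \<bar>1 / sqrt (\<bar>smooth (h n) f x\<bar> + \<delta>) - 1 / sqrt (f x + \<delta>)\<bar>"
        by (simp add: abs_mult right_diff_distrib[symmetric] del: times_divide_eq_right)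
      also have "\<dots> \<le> b * (\<bar>\<bar>smooth (h n) f x\<bar> - f x\<bar> / (\<delta> * sqrt \<delta>))"
        using r b f_nonneg by (intro mult_mono inverse_sqrt_lipschitz[OF \<delta>]) auto
      finally show ?thesis using smooth_f_nonneg[OF elim, of x] by simp
    qed
    have int: "integrable lborel (\<lambda>x. ?L * \<bar>smooth (h n) f x - f x\<bar>)"
      using integrable_smooth[OF elim f_int] f_int by simp
    have "integrable lborel (?D n)"
    proof (rule Bochner_Integration.integrable_bound[OF int])
      show "AE x in lborel. norm (?D n x) \<le> norm (?L * \<bar>smooth (h n) f x - f x\<bar>)"
        unfolding real_norm_def by (intro AE_I2 order.trans[OF pt abs_ge_self])
    qed measurable
    then have "(\<integral>x. \<bar>?D n x\<bar> \<partial>lborel) \<le> (\<integral>x. ?L * \<bar>smooth (h n) f x - f x\<bar> \<partial>lborel)"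
      using int by (intro integral_mono pt) auto
    then show ?case by simp
  qed
qed

text \<open>All tolerances are measured in units of \<open>gini\<close>, which is positive because
  at least two labels have densities bounded below on \<open>A\<close>. The risk stays below 1.2
  \<open>gini\<close>, while twice the similarity sum exceeds 1.3 \<open>gini\<close>.\<close>

lemma plugin_risk_AE:
  assumes bw: "bandwidth_condition CARD('d) \<gamma> h" "0 < \<gamma>" and JQ: "J \<subseteq> {1..Q}"
    and two: "\<And>i. i \<in> J \<Longrightarrow> \<exists>j\<in>J. j \<noteq> i"
    and c: "0 < c" "\<And>i x. i \<in> J \<Longrightarrow> x \<in> A \<Longrightarrow> c \<le> g i x"
    and supp: "AE \<omega> in M. fst (Z0 \<omega>) \<in> A \<and> snd (Z0 \<omega>) \<in> J"
  shows "AE \<omega> in M. \<forall>\<^sub>F n in sequentially.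
    \<forall>F. plugin_classifier Q n (h n) (\<lambda>l. fst (Z l \<omega>)) (\<lambda>l. snd (Z l \<omega>)) F \<longrightarrow>
      misclassification_error M (\<lambda>\<omega>. fst (Z0 \<omega>)) (\<lambda>\<omega>. snd (Z0 \<omega>)) F
        \<le> 2 * ((\<Sum>l = 1..n. \<Sum>m = 1..n. theta (snd (Z l \<omega>)) (snd (Z m \<omega>)) *
              G_sim n (h n) (\<lambda>l. fst (Z l \<omega>)) (fst (Z l \<omega>)) (fst (Z m \<omega>))) / (real n)\<^sup>2)"
proof -
  have hpos: "0 < h n" if "1 \<le> n" for n
    using bw that by (simp add: bandwidth_condition_def)
  have h_ev: "\<forall>\<^sub>F n in sequentially. 0 < h n"
    using eventually_ge_at_top[of 1] by eventually_elim (rule hpos)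
  have h_lim: "h \<longlonglongrightarrow> 0" using bw by (simp add: bandwidth_condition_def)
  have "J \<noteq> {}" using sum_integral_g by auto
  then obtain i0 where i0: "i0 \<in> J" by auto
  define F0 where "F0 = card J * B"
  have F0: "f x \<le> F0" for x using f_le by (simp add: F0_def)
  have f_ge: "c \<le> f x" if "x \<in> A" for x
    using c(2)[OF i0 that] g_le_f[of i0 x] by linarith
  have A_ne: "A \<noteq> {}"
  proof
    assume "A = {}"
    then have "g i x = 0" for i x using g_off by simp
    then show False using sum_integral_g by simp
  qed
  then have F0pos: "0 < F0" using f_ge F0 c(1) by (meson all_not_in_conv less_le_trans order.trans)
  \<comment> \<open>On \<open>A\<close> a second label j gives f - g i \<ge> g j \<ge> c. Each
    summand is thus at least c / F0 times the mass of \<open>g i\<close>, and these masses add up to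
    1.\<close>
  have gini_pos: "0 < gini"
  proof -
    have "c / F0 * (\<integral>x. g i x \<partial>lborel) \<le> (\<integral>x. g i x * (f x - g i x) / f x \<partial>lborel)" if i: "i \<in> J" for i
    proof -
      have "(\<integral>x. c / F0 * g i x \<partial>lborel) \<le> (\<integral>x. g i x * (f x - g i x) / f x \<partial>lborel)"
      proof (rule integral_mono)
        fix x
        show "c / F0 * g i x \<le> g i x * (f x - g i x) / f x"
        proof (cases "x \<in> A")
          case True
          obtain j where j: "j \<in> J" "j \<noteq> i" using two[OF i] by blast
          have "g i x + g j x = (\<Sum>k\<in>{i, j}. g k x)" using j by simp
          also have "\<dots> \<le> f x" unfolding f_def using i j J g_nonneg by (intro sum_mono2) auto
          finally have "c \<le> f x - g i x" using c(2)[OF j(1) True] by linarith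
          then have "c / F0 \<le> (f x - g i x) / f x"
            using f_ge[OF True] F0[of x] c(1) by (intro frac_le) auto
          then show ?thesis using mult_right_mono[OF _ g_nonneg[of i x]] by (fastforce simp: mult_ac)
        qed (simp add: g_off)
      qed (use g_int gini_summand_int in auto)
      then show ?thesis by simp
    qed
    then have "(\<Sum>i\<in>J. c / F0 * (\<integral>x. g i x \<partial>lborel)) \<le> gini"
      unfolding gini_def by (rule sum_mono)
    moreover have "(\<Sum>i\<in>J. c / F0 * (\<integral>x. g i x \<partial>lborel)) = c / F0"
      by (simp only: sum_distrib_left[symmetric] sum_integral_g mult_1_right)
    moreover have "0 < c / F0" using c F0pos by simp
    ultimately show ?thesis by linarith
  qed
  \<comment> \<open>As f \<ge> c on \<open>A\<close>, this choice gives f + \<delta> \<le> (4/3) f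
    there, which is the source of the factor 3/4.\<close>
  define \<delta> where "\<delta> = c / 3"
  have \<delta>: "0 < \<delta>" using c by (simp add: \<delta>_def)
  define r where "r = 1 / sqrt \<delta>"
  have r: "0 < r" using \<delta> by (simp add: r_def)
  \<comment> \<open>The absolute value only keeps \<open>\<rho>\<close> bounded when \<open>h n \<le> 0\<close>, which can happen for \<open>n = 0\<close>.\<close>
  define \<rho> where "\<rho> n x = 1 / sqrt (\<bar>smooth (h n) f x\<bar> + \<delta>)" for n x
  define \<rho>' where "\<rho>' x = 1 / sqrt (f x + \<delta>)" for x
  have \<rho>_meas [measurable]: "\<rho> n \<in> borel_measurable borel" "\<rho>' \<in> borel_measurable borel" for n
    unfolding \<rho>_def[abs_def] \<rho>'_def[abs_def] by measurable
  have \<rho>: "0 \<le> \<rho> n x" "\<rho> n x \<le> r" and \<rho>': "0 \<le> \<rho>' x" "\<rho>' x \<le> r" for n x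
    using \<delta> f_nonneg[of x] by (auto simp: \<rho>_def \<rho>'_def r_def intro!: divide_left_mono mult_pos_pos)
  have F0_mult: "\<bar>s * (f x - g i x)\<bar> \<le> r * F0" "\<bar>g i x * s\<bar> \<le> r * F0" if "0 \<le> s" "s \<le> r" for s i x
  proof -
    have 1: "0 \<le> f x - g i x" "f x - g i x \<le> F0" "0 \<le> g i x" "g i x \<le> F0"
      using g_nonneg[of i x] g_le_f[of i x] F0[of x] by auto
    show "\<bar>s * (f x - g i x)\<bar> \<le> r * F0" unfolding abs_mult using 1 that r F0pos by (intro mult_mono) auto
    show "\<bar>g i x * s\<bar> \<le> r * F0" using 1 that r F0pos
      unfolding abs_mult by (subst mult.commute, intro mult_mono) auto
  qed
  have int_fg: "integrable lborel (\<lambda>y. s y * (f y - g i y))" "integrable lborel (\<lambda>y. g i y * s y)"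
    if [measurable]: "s \<in> borel_measurable borel" and s: "\<And>y. 0 \<le> s y" "\<And>y. s y \<le> r" for s i
    using F0_mult s by (auto intro!: integrable_on_A[where b = "r * F0"] simp: f_off g_off)
  \<comment> \<open>The mean of the inner similarity sum at x for a point with label
    \<open>i\<close>.\<close>
  define q where "q n i x = smooth (h n) (\<lambda>y. \<rho> n y * (f y - g i y)) x" for n i x
  have q_meas [measurable]: "q n i \<in> borel_measurable borel" for n i
    unfolding q_def[abs_def] by measurable
  have q: "0 \<le> q n i x" "q n i x \<le> r * F0" if "0 < h n" for n i x
  proof -
    show "0 \<le> q n i x" unfolding q_def using g_le_f \<rho> by (intro smooth_nonneg that mult_nonneg_nonneg) auto
    have "\<bar>q n i x\<bar> \<le> r * F0" unfolding q_def
      using \<rho> by (intro smooth_abs_le that int_fg F0_mult) auto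
    then show "q n i x \<le> r * F0" by simp
  qed
  \<comment> \<open>The mean of the outer average once the inner sums are replaced by
    \<open>q\<close>.\<close>
  define I where "I n = (\<Sum>i\<in>J. \<integral>x. \<rho> n x * q n i x * g i x \<partial>lborel)" for n
  have I_lim: "I \<longlonglongrightarrow> (\<Sum>i\<in>J. \<integral>x. (g i x * \<rho>' x) * (\<rho>' x * (f x - g i x)) \<partial>lborel)"
    unfolding I_def[abs_def]
  proof (rule tendsto_sum)
    fix i assume "i \<in> J"
    have "(\<lambda>n. \<integral>x. (g i x * \<rho> n x) * smooth (h n) (\<lambda>y. \<rho> n y * (f y - g i y)) x \<partial>lborel)
        \<longlonglongrightarrow> (\<integral>x. (g i x * \<rho>' x) * (\<rho>' x * (f x - g i x)) \<partial>lborel)"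
    proof (rule smooth_bilinear_tendsto[OF h_ev h_lim, where R = "r * F0"])
      show "(\<lambda>n. \<integral>x. \<bar>g i x * \<rho> n x - g i x * \<rho>' x\<bar> \<partial>lborel) \<longlonglongrightarrow> 0"
        unfolding \<rho>_def \<rho>'_def
        using g_nonneg g_le by (intro regularised_weight_tendsto[OF h_ev h_lim \<delta>, where b = B]) (auto simp: g_off)
      have "\<bar>f x - g i x\<bar> \<le> F0" for x
        using g_nonneg[of i x] g_le_f[of i x] F0[of x] by linarith
      then have "(\<lambda>n. \<integral>x. \<bar>(f x - g i x) * \<rho> n x - (f x - g i x) * \<rho>' x\<bar> \<partial>lborel) \<longlonglongrightarrow> 0"
        unfolding \<rho>_def \<rho>'_def
        by (intro regularised_weight_tendsto[OF h_ev h_lim \<delta>, where b = F0]) (auto simp: g_off f_off)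
      then show "(\<lambda>n. \<integral>x. \<bar>\<rho> n x * (f x - g i x) - \<rho>' x * (f x - g i x)\<bar> \<partial>lborel) \<longlonglongrightarrow> 0"
        by (simp add: mult.commute)
    qed (use \<rho> \<rho>' int_fg F0_mult in auto)
    then show "(\<lambda>n. \<integral>x. \<rho> n x * q n i x * g i x \<partial>lborel) \<longlonglongrightarrow> (\<integral>x. (g i x * \<rho>' x) * (\<rho>' x * (f x - g i x)) \<partial>lborel)"
      by (simp add: q_def mult_ac)
  qed
  have gini_le: "3 / 4 * gini \<le> (\<Sum>i\<in>J. \<integral>x. (g i x * \<rho>' x) * (\<rho>' x * (f x - g i x)) \<partial>lborel)"
    unfolding gini_def sum_distrib_left
  proof (rule sum_mono)
    fix i assume "i \<in> J"
    have "(\<integral>x. 3 / 4 * (g i x * (f x - g i x) / f x) \<partial>lborel) \<le> (\<integral>x. (g i x * \<rho>' x) * (\<rho>' x * (f x - g i x)) \<partial>lborel)"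
    proof (rule integral_mono)
      show "integrable lborel (\<lambda>x. (g i x * \<rho>' x) * (\<rho>' x * (f x - g i x)))"
      proof (rule integrable_on_A[where b = "(r * F0) * (r * F0)"])
        show "\<bar>(g i x * \<rho>' x) * (\<rho>' x * (f x - g i x))\<bar> \<le> (r * F0) * (r * F0)" for x
          unfolding abs_mult[of "g i x * \<rho>' x"] using F0_mult \<rho>' r F0pos by (intro mult_mono) auto
      qed (auto simp: g_off)
      fix x
      \<comment> \<open>The weights of the two points of a pair merge in the limit into 1 / (f +
        \<delta>), the regularised form of the 1 / f in \<open>gini\<close>.\<close>
      have sq: "\<rho>' x * \<rho>' x = 1 / (f x + \<delta>)" using f_nonneg[of x] \<delta> by (simp add: \<rho>'_def)
      have "(g i x * \<rho>' x) * (\<rho>' x * (f x - g i x)) = (g i x * (f x - g i x)) * (\<rho>' x * \<rho>' x)"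
        by (simp add: mult_ac)
      also have "\<dots> = g i x * (f x - g i x) / (f x + \<delta>)" unfolding sq by simp
      finally have eq: "(g i x * \<rho>' x) * (\<rho>' x * (f x - g i x)) = g i x * (f x - g i x) / (f x + \<delta>)" .
      show "3 / 4 * (g i x * (f x - g i x) / f x) \<le> (g i x * \<rho>' x) * (\<rho>' x * (f x - g i x))"
      proof (cases "x \<in> A")
        case True
        have fx: "0 < f x" "f x + \<delta> \<le> 4 / 3 * f x" using f_ge[OF True] c by (auto simp: \<delta>_def)
        have "0 \<le> g i x * (f x - g i x)" using g_nonneg g_le_f by (intro mult_nonneg_nonneg) auto
        then have "g i x * (f x - g i x) / (4 / 3 * f x) \<le> g i x * (f x - g i x) / (f x + \<delta>)"
          using fx \<delta> by (intro divide_left_mono) auto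
        then show ?thesis unfolding eq by simp
      qed (simp add: g_off)
    qed (intro integrable_mult_right gini_summand_int)
    then show "3 / 4 * (\<integral>x. g i x * (f x - g i x) / f x \<partial>lborel) \<le> (\<integral>x. (g i x * \<rho>' x) * (\<rho>' x * (f x - g i x)) \<partial>lborel)"
      unfolding integral_mult_right_zero .
  qed
  \<comment> \<open>Any factor below 3/4 is eventually exceeded; 7/10 leaves room for the error
    terms.\<close>
  have I_ev: "\<forall>\<^sub>F n in sequentially. 7 / 10 * gini < I n"
    using order_tendstoD(1)[OF I_lim, of "7 / 10 * gini"] gini_le gini_pos by simp
  have L1_ev: "\<forall>\<^sub>F n in sequentially. (\<Sum>i\<in>J. \<integral>x. \<bar>smooth (h n) (g i) x - g i x\<bar> \<partial>lborel) < gini / 20"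
  proof -
    have "(\<lambda>n. \<Sum>i\<in>J. \<integral>x. \<bar>smooth (h n) (g i) x - g i x\<bar> \<partial>lborel) \<longlonglongrightarrow> (\<Sum>i\<in>J. 0)"
      by (intro tendsto_sum smooth_L1_tendsto h_ev h_lim g_int)
    then show ?thesis using gini_pos by (intro order_tendstoD(2)[of _ 0]) auto
  qed
  define mA where "mA = measure lborel A"
  have mA: "0 \<le> mA" by (simp add: mA_def)
  \<comment> \<open>The three caps serve the bound of \<open>kde\<close> by its mean plus \<delta>,
    the loss \<epsilon> + \<epsilon> r in the similarity sum, and the loss on \<open>A\<close> in
    the risk. Writing 1 + mA spares a proof that \<open>mA\<close> is positive.\<close>
  define \<epsilon> where "\<epsilon> = min \<delta> (min (gini / (20 * (1 + r))) (gini / (20 * (1 + mA))))"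
  have \<epsilon>: "0 < \<epsilon>" "\<epsilon> \<le> \<delta>" using \<delta> gini_pos r mA by (auto simp: \<epsilon>_def)
  have \<epsilon>r: "\<epsilon> + \<epsilon> * r \<le> gini / 20"
  proof -
    have "\<epsilon> \<le> gini / (20 * (1 + r))" by (simp add: \<epsilon>_def)
    then have "\<epsilon> * (20 * (1 + r)) \<le> gini" using r by (simp add: pos_le_divide_eq)
    then show ?thesis by (simp add: algebra_simps)
  qed
  have \<epsilon>A: "\<epsilon> * mA \<le> gini / 20"
  proof -
    have "\<epsilon> \<le> gini / (20 * (1 + mA))" by (simp add: \<epsilon>_def)
    then have "\<epsilon> * (20 * (1 + mA)) \<le> gini" using mA by (simp add: pos_le_divide_eq)
    then show ?thesis using \<epsilon> by (simp add: algebra_simps)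
  qed
  have unif: "AE \<omega> in M. \<forall>\<^sub>F n in sequentially. \<forall>x. (\<forall>i. \<bar>x $ i\<bar> \<le> R) \<longrightarrow>
      \<bar>weighted_kde n (h n) (\<lambda>l. Z l \<omega>) (w n) x - weighted_mean (h n) (w n) x\<bar> \<le> \<epsilon>"
    if [measurable]: "\<And>n. w n \<in> borel_measurable (borel \<Otimes>\<^sub>M count_space UNIV)" and w: "\<And>n z. 0 \<le> w n z \<and> w n z \<le> W"
    for w :: "nat \<Rightarrow> (real ^ 'd) \<times> nat \<Rightarrow> real" and W
  proof (rule weighted_kde_uniform_AE[OF bw, where W = W and m = "card J * (W * B)"])
    show "weighted_mean (h n) (w n) x \<le> card J * (W * B)" if "1 \<le> n" for n x
      using w by (intro weighted_mean_le hpos that) (auto intro: abs_leI order.trans[of _ 0])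
  qed (use w \<epsilon> R in auto)
  have u1: "AE \<omega> in M. \<forall>\<^sub>F n in sequentially. \<forall>x. (\<forall>i. \<bar>x $ i\<bar> \<le> R) \<longrightarrow>
      \<bar>weighted_kde n (h n) (\<lambda>l. Z l \<omega>) (\<lambda>_. 1) x - weighted_mean (h n) (\<lambda>_. 1) x\<bar> \<le> \<epsilon>"
    by (rule unif[of "\<lambda>_ _. 1" 1]) auto
  have u2: "AE \<omega> in M. \<forall>i\<in>J. \<forall>\<^sub>F n in sequentially. \<forall>x. (\<forall>i. \<bar>x $ i\<bar> \<le> R) \<longrightarrow>
      \<bar>weighted_kde n (h n) (\<lambda>l. Z l \<omega>) (\<lambda>z. of_bool (snd z = i)) x
        - weighted_mean (h n) (\<lambda>z. of_bool (snd z = i)) x\<bar> \<le> \<epsilon>"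
    unfolding AE_finite_all[OF J]
    by (intro ballI unif[of "\<lambda>_ z. of_bool (snd z = _)" 1]) auto
  have u3: "AE \<omega> in M. \<forall>i\<in>J. \<forall>\<^sub>F n in sequentially. \<forall>x. (\<forall>i. \<bar>x $ i\<bar> \<le> R) \<longrightarrow>
      \<bar>weighted_kde n (h n) (\<lambda>l. Z l \<omega>) (\<lambda>z. of_bool (snd z \<noteq> i) * \<rho> n (fst z)) x
        - weighted_mean (h n) (\<lambda>z. of_bool (snd z \<noteq> i) * \<rho> n (fst z)) x\<bar> \<le> \<epsilon>"
    unfolding AE_finite_all[OF J]
    using \<rho> r by (intro ballI unif[of "\<lambda>n z. of_bool (snd z \<noteq> _) * \<rho> n (fst z)" r]) (auto simp: of_bool_def)
  define \<phi> where "\<phi> n z = \<rho> n (fst z) * q n (snd z) (fst z)" for n and z :: "(real ^ 'd) \<times> nat"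
  have \<phi>_meas [measurable]: "\<phi> n \<in> borel_measurable (borel \<Otimes>\<^sub>M count_space UNIV)" for n
    unfolding \<phi>_def[abs_def]
    by (rule measurable_compose_countable[of "\<lambda>i z. \<rho> n (fst z) * q n i (fst z)" _ _ snd]) measurable
  have \<phi>: "0 \<le> \<phi> n z" "\<phi> n z \<le> r * (r * F0)" if "0 < h n" for n z
    using \<rho> q[OF that] r F0pos unfolding \<phi>_def by (auto intro!: mult_mono)
  have b0: "0 < r * (r * F0)" using r F0pos by simp
  have \<phi>_mean: "expectation (\<lambda>\<omega>. \<phi> n (Z0 \<omega>)) = I n" if "0 < h n" for n
    unfolding I_def using law[of "\<phi> n" "r * (r * F0)"] \<phi>[OF that] by (simp add: \<phi>_def)
  \<comment> \<open>The outer average involves a single function for each n, hence the singleton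
    index set, and its range stays bounded as n grows. The maximum in the mean bound supplies the
    condition \<epsilon> \<le> 2 m.\<close>
  have u4: "AE \<omega> in M. \<forall>\<^sub>F n in sequentially. \<forall>i\<in>{()}.
      \<bar>(\<Sum>l = 1..n. \<phi> n (Z l \<omega>)) / n - expectation (\<lambda>\<omega>. \<phi> n (Z0 \<omega>))\<bar> < \<epsilon>"
  proof (rule sample_means_AE[where C = 1 and p = 0 and B = 1 and b = "\<lambda>_. r * (r * F0)" and m = "max \<epsilon> (r * (r * F0))"])
    show "\<forall>\<^sub>F n in sequentially. real (card {()}) \<le> 1 * real n powr 0"
      using eventually_ge_at_top[of 1] by eventually_elim simp
    show "\<forall>\<^sub>F n in sequentially. \<forall>i\<in>{()}. \<forall>z\<in>space (borel \<Otimes>\<^sub>M count_space UNIV). 0 \<le> \<phi> n z \<and> \<phi> n z \<le> r * (r * F0)"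
      using h_ev by eventually_elim (use \<phi> in auto)
    show "\<forall>\<^sub>F n in sequentially. \<forall>i\<in>{()}. expectation (\<lambda>\<omega>. \<phi> n (Z0 \<omega>)) \<le> max \<epsilon> (r * (r * F0))"
      using h_ev
    proof eventually_elim
      case (elim n)
      have "integrable M (\<lambda>\<omega>. \<phi> n (Z0 \<omega>))"
        using \<phi>[OF elim] by (intro integrable_const_bound[where B = "r * (r * F0)"]) auto
      then have "expectation (\<lambda>\<omega>. \<phi> n (Z0 \<omega>)) \<le> r * (r * F0)"
        using \<phi>[OF elim] by (intro integral_le_const) auto
      then show ?case by simp
    qed
    have "\<forall>\<^sub>F n :: nat in sequentially. r * (r * F0) * (ln (real n))\<^sup>2 \<le> 1 * real n"
      using b0 by real_asymp
    then show "\<forall>\<^sub>F n :: nat in sequentially. 0 < r * (r * F0) \<and> r * (r * F0) * (ln (real n))\<^sup>2 \<le> 1 * real n"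
      by eventually_elim (use b0 in auto)
  qed (use \<epsilon> in auto)
  have u5: "AE \<omega> in M. \<forall>l\<ge>1. fst (Z l \<omega>) \<in> A \<and> snd (Z l \<omega>) \<in> J"
  proof (rule AE_sample[OF _ supp])
    show "{z \<in> space (borel \<Otimes>\<^sub>M count_space UNIV). fst z \<in> A \<and> snd z \<in> J} \<in> sets (borel \<Otimes>\<^sub>M count_space UNIV)"
      by measurable
  qed
  show ?thesis
    using u1 u2 u3 u4 u5
  proof eventually_elim
    case (elim \<omega>)
    define xs ys where "xs = (\<lambda>l. fst (Z l \<omega>))" and "ys = (\<lambda>l. snd (Z l \<omega>))"
    have Z_eq: "(\<lambda>l. Z l \<omega>) = (\<lambda>l. (xs l, ys l))" by (simp add: xs_def ys_def)
    have xsA: "xs l \<in> A" and ysJ: "ys l \<in> J" if "l \<in> {1..n}" for l n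
      using elim(5) that by (auto simp: xs_def ys_def)
    have A_cube: "\<forall>i. \<bar>x $ i\<bar> \<le> R" if "x \<in> A" for x using A_box[OF that] by simp
    have u2': "\<forall>\<^sub>F n in sequentially. \<forall>i\<in>J. \<forall>x. (\<forall>i. \<bar>x $ i\<bar> \<le> R) \<longrightarrow>
      \<bar>weighted_kde n (h n) (\<lambda>l. Z l \<omega>) (\<lambda>z. of_bool (snd z = i)) x
        - weighted_mean (h n) (\<lambda>z. of_bool (snd z = i)) x\<bar> \<le> \<epsilon>"
      using elim(2) by (intro eventually_ball_finite J) auto
    have u3': "\<forall>\<^sub>F n in sequentially. \<forall>i\<in>J. \<forall>x. (\<forall>i. \<bar>x $ i\<bar> \<le> R) \<longrightarrow>
      \<bar>weighted_kde n (h n) (\<lambda>l. Z l \<omega>) (\<lambda>z. of_bool (snd z \<noteq> i) * \<rho> n (fst z)) x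
        - weighted_mean (h n) (\<lambda>z. of_bool (snd z \<noteq> i) * \<rho> n (fst z)) x\<bar> \<le> \<epsilon>"
      using elim(3) by (intro eventually_ball_finite J) auto
    have "\<forall>\<^sub>F n in sequentially. \<forall>F. plugin_classifier Q n (h n) xs ys F \<longrightarrow>
      misclassification_error M (\<lambda>\<omega>. fst (Z0 \<omega>)) (\<lambda>\<omega>. snd (Z0 \<omega>)) F
        \<le> 2 * ((\<Sum>l = 1..n. \<Sum>m = 1..n. theta (ys l) (ys m) * G_sim n (h n) xs (xs l) (xs m)) / (real n)\<^sup>2)"
      using elim(1) u2' u3' elim(4) I_ev L1_ev eventually_ge_at_top[of 1]
    proof eventually_elim
      case (elim n)
      have n: "1 \<le> n" and hn: "0 < h n" using elim hpos by auto
      have lower: "I n - \<epsilon> - \<epsilon> * r \<le> (\<Sum>l = 1..n. \<Sum>m = 1..n. theta (ys l) (ys m) * G_sim n (h n) xs (xs l) (xs m)) / (real n)\<^sup>2"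
      proof (rule similarity_sum_ge[where \<rho> = "\<rho> n" and q = "q n" and v = "\<lambda>x. \<bar>smooth (h n) f x\<bar> + \<delta>", OF n hn])
        fix l assume l: "l \<in> {1..n}"
        have "\<bar>kde n (h n) xs (xs l) - smooth (h n) f (xs l)\<bar> \<le> \<epsilon>"
          using mp[OF spec[OF elim(1)] A_cube[OF xsA[OF l]]]
          unfolding kde_eq_weighted_kde[where ys = ys] Z_eq weighted_mean_1[OF hn] .
        then show "kde n (h n) xs (xs l) \<le> \<bar>smooth (h n) f (xs l)\<bar> + \<delta>" using \<epsilon> by linarith
        have "weighted_mean (h n) (\<lambda>z. of_bool (snd z \<noteq> ys l) * \<rho> n (fst z)) (xs l) = q n (ys l) (xs l)"
          unfolding q_def using \<rho> by (intro weighted_mean_other_labels[OF hn ysJ[OF l], where r = r]) auto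
        then show "\<bar>weighted_kde n (h n) (\<lambda>l. (xs l, ys l)) (\<lambda>z. of_bool (snd z \<noteq> ys l) * \<rho> n (fst z)) (xs l)
            - q n (ys l) (xs l)\<bar> \<le> \<epsilon>"
          using mp[OF spec[OF bspec[OF elim(3) ysJ[OF l]]] A_cube[OF xsA[OF l]]] unfolding Z_eq by simp
      next
        show "\<bar>(\<Sum>l = 1..n. \<rho> n (xs l) * q n (ys l) (xs l)) / n - I n\<bar> \<le> \<epsilon>"
          using elim(4) unfolding \<phi>_mean[OF hn] by (simp add: \<phi>_def xs_def ys_def)
      qed (use \<rho> in \<open>auto simp: \<rho>_def\<close>)
      show ?case
      proof (intro allI impI)
        fix F assume F: "plugin_classifier Q n (h n) xs ys F"
        have FJ: "F x \<in> J" for x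
          using plugin_classifier_observed_label[OF F n hn _ JQ] ysJ by blast
        have "misclassification_error M (\<lambda>\<omega>. fst (Z0 \<omega>)) (\<lambda>\<omega>. snd (Z0 \<omega>)) F
            \<le> gini + 2 * \<epsilon> * measure lborel A + 2 * (\<Sum>i\<in>J. \<integral>x. \<bar>smooth (h n) (g i) x - g i x\<bar> \<partial>lborel)"
        proof (rule misclassification_error_le[where
              g' = "\<lambda>i. weighted_kde n (h n) (\<lambda>l. (xs l, ys l)) (\<lambda>z. of_bool (snd z = i))"])
          show "F \<in> measurable borel (count_space UNIV)" using F by (simp add: plugin_classifier_def)
          show "\<bar>weighted_kde n (h n) (\<lambda>l. (xs l, ys l)) (\<lambda>z. of_bool (snd z = i)) x - smooth (h n) (g i) x\<bar> \<le> \<epsilon>"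
            if "i \<in> J" "x \<in> A" for i x
            using mp[OF spec[OF bspec[OF elim(2) that(1)]] A_cube[OF that(2)]]
            unfolding Z_eq weighted_mean_label[OF hn that(1)] .
          show "weighted_kde n (h n) (\<lambda>l. (xs l, ys l)) (\<lambda>z. of_bool (snd z = i)) x
              \<le> weighted_kde n (h n) (\<lambda>l. (xs l, ys l)) (\<lambda>z. of_bool (snd z = F x)) x" if "i \<in> J" for i x
            using plugin_classifier_maximises[OF F n hn] JQ that by blast
        qed (use FJ integrable_smooth[OF hn g_int] in auto)
        \<comment> \<open>The two added terms are \<open>gini\<close>/10 each, which makes 12/10; on
          the other side, twice 7/10 - 1/20 leaves 13/10.\<close>
        also have "\<dots> \<le> gini + 2 * (gini / 20) + 2 * (gini / 20)"
          using \<epsilon>A elim(6) by (simp add: mA_def)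
        also have "\<dots> \<le> 2 * (I n - \<epsilon> - \<epsilon> * r)"
          using elim(5) \<epsilon>r gini_pos by simp
        also have "\<dots> \<le> 2 * ((\<Sum>l = 1..n. \<Sum>m = 1..n. theta (ys l) (ys m) * G_sim n (h n) xs (xs l) (xs m)) / (real n)\<^sup>2)"
          by (rule mult_left_mono[OF lower]) simp
        finally show "misclassification_error M (\<lambda>\<omega>. fst (Z0 \<omega>)) (\<lambda>\<omega>. snd (Z0 \<omega>)) F
            \<le> 2 * ((\<Sum>l = 1..n. \<Sum>m = 1..n. theta (ys l) (ys m) * G_sim n (h n) xs (xs l) (xs m)) / (real n)\<^sup>2)" .
      qed
    qed
    then show ?case by (simp add: xs_def ys_def)
  qed
qed

end

section \<open>The error bound\<close>

lemma (in prob_space) integral_uniform_measure: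
  fixes u :: "'a \<Rightarrow> real"
  assumes [measurable]: "S \<in> events" "u \<in> borel_measurable M" and S: "0 < prob S"
  shows "(\<integral>\<omega>. u \<omega> \<partial>uniform_measure M S) = expectation (\<lambda>\<omega>. indicator S \<omega> * u \<omega>) / prob S"
proof -
  have "uniform_measure M S = density M (\<lambda>\<omega>. ennreal (indicator S \<omega> / prob S))"
    unfolding uniform_measure_def
    using S by (intro density_cong AE_I2)
      (auto simp: emeasure_eq_measure divide_ennreal ennreal_1[symmetric] simp del: ennreal_1 split: split_indicator)
  then have "(\<integral>\<omega>. u \<omega> \<partial>uniform_measure M S) = expectation (\<lambda>\<omega>. indicator S \<omega> / prob S * u \<omega>)"
    using S by (simp add: integral_real_density)
  then show ?thesis by simp
qed

theorem theorem3:
  fixes M :: "'w measure"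
    and X :: "'w \<Rightarrow> real ^ 'd" and Y :: "'w \<Rightarrow> nat"
    and Xs :: "nat \<Rightarrow> 'w \<Rightarrow> real ^ 'd" and Ys :: "nat \<Rightarrow> 'w \<Rightarrow> nat"
    and \<X> :: "(real ^ 'd) set" and M0 :: real and Q :: nat
    and f :: "real ^ 'd \<Rightarrow> real" and fc :: "nat \<Rightarrow> real ^ 'd \<Rightarrow> real"
    and fmin fmax \<gamma> :: real and fcmin fcmax c :: "nat \<Rightarrow> real"
    and h :: "nat \<Rightarrow> real"
  assumes prob: "prob_space M"
    and X_rv: "X \<in> measurable M borel" and Y_rv: "Y \<in> measurable M (count_space UNIV)"
    and X_range: "AE \<omega> in M. X \<omega> \<in> \<X>" and Y_range: "AE \<omega> in M. Y \<omega> \<in> {1..Q}"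
    and X_bounded: "\<X> \<subseteq> {x. \<forall>i. x $ i \<in> {-M0..M0}}"
    and indep: "prob_space.indep_vars M (\<lambda>_. borel \<Otimes>\<^sub>M count_space UNIV)
                  (\<lambda>l \<omega>. (Xs l \<omega>, Ys l \<omega>)) {1..}"
    and ident: "\<And>l. l \<ge> 1 \<Longrightarrow>
                  distr M (borel \<Otimes>\<^sub>M count_space UNIV) (\<lambda>\<omega>. (Xs l \<omega>, Ys l \<omega>)) =
                  distr M (borel \<Otimes>\<^sub>M count_space UNIV) (\<lambda>\<omega>. (X \<omega>, Y \<omega>))"
    and f_meas: "f \<in> borel_measurable borel" and f_nonneg: "\<And>x. 0 \<le> f x"
    and f_density: "distributed M lborel X (\<lambda>x. ennreal (f x))"
    and fc_meas: "\<And>i. i \<in> {1..Q} \<Longrightarrow> fc i \<in> borel_measurable borel"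
    and fc_nonneg: "\<And>i x. i \<in> {1..Q} \<Longrightarrow> 0 \<le> fc i x"
    and fc_density: "\<And>i. i \<in> {1..Q} \<Longrightarrow> 0 < measure M {\<omega> \<in> space M. Y \<omega> = i} \<Longrightarrow>
                  distributed (uniform_measure M {\<omega> \<in> space M. Y \<omega> = i}) lborel X
                    (\<lambda>x. ennreal (fc i x))"
    and A1: "0 < fmin" "\<And>x. x \<in> \<X> \<Longrightarrow> fmin \<le> f x \<and> f x \<le> fmax"
    and C1: "\<And>i. i \<in> {1..Q} \<Longrightarrow> 0 < fcmin i"
            "\<And>i x. i \<in> {1..Q} \<Longrightarrow> x \<in> \<X> \<Longrightarrow> fcmin i \<le> fc i x \<and> fc i x \<le> fcmax i"
    and C2: "0 < \<gamma>"
            "\<And>i x y. i \<in> {1..Q} \<Longrightarrow> x \<in> \<X> \<Longrightarrow> y \<in> \<X> \<Longrightarrow>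
                  \<bar>fc i x - fc i y\<bar> \<le> c i * norm (x - y) powr \<gamma>"
    and B: "bandwidth_condition CARD('d) \<gamma> h"
  shows "\<exists>C. AE \<omega> in M. \<forall>\<^sub>F n in sequentially.
           \<forall>F. plugin_classifier Q n (h n) (\<lambda>l. Xs l \<omega>) (\<lambda>l. Ys l \<omega>) F \<longrightarrow>
             misclassification_error M X Y F
               \<le> 2 / (real n)\<^sup>2 *
                   (\<Sum>l = 1..n. \<Sum>m = 1..n.
                      theta (Ys l \<omega>) (Ys m \<omega>) *
                      G_sim n (h n) (\<lambda>k. Xs k \<omega>) (Xs l \<omega>) (Xs m \<omega>))
                 + C * h n powr \<gamma>"
proof -
  interpret prob_space M by (rule prob)
  note [measurable] = X_rv Y_rv
  define p where "p i = measure M {\<omega> \<in> space M. Y \<omega> = i}" for i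
  \<comment> \<open>Labels of probability 0 are dropped: they have no conditional law, and almost
    surely they do not occur.\<close>
  define J where "J = {i \<in> {1..Q}. 0 < p i}"
  \<comment> \<open>\<open>\<X>\<close> need not be Borel, so it is replaced by a Borel set that contains it and on which the same
    density bounds hold.\<close>
  define A where "A = {x. (\<forall>k. \<bar>x $ k\<bar> \<le> \<bar>M0\<bar>) \<and> (\<forall>i\<in>J. fcmin i \<le> fc i x \<and> fc i x \<le> fcmax i)}"
  \<comment> \<open>The bounds on \<open>fc\<close> hold on \<open>A\<close>, so the class densities
    are cut off there; since X lies in \<open>A\<close> almost surely, no mass is lost.\<close>
  define g where "g i x = (if i \<in> J then p i * fc i x * indicator A x else 0)" for i x
  define B' where "B' = (\<Sum>i\<in>J. \<bar>fcmax i\<bar>)"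
  define Z0 where "Z0 \<omega> = (X \<omega>, Y \<omega>)" for \<omega>
  define Z where "Z l \<omega> = (Xs l \<omega>, Ys l \<omega>)" for l \<omega>
  have J: "finite J" "J \<subseteq> {1..Q}" by (auto simp: J_def)
  have fcJ [measurable]: "i \<in> J \<Longrightarrow> fc i \<in> borel_measurable borel" for i
    using fc_meas J by auto
  have p: "0 < p i" "p i \<le> 1" if "i \<in> J" for i
    using that by (auto simp: J_def p_def)
  have A_sets [measurable]: "A \<in> sets borel"
  proof -
    have "closed {x :: real ^ 'd. \<forall>k. \<bar>x $ k\<bar> \<le> \<bar>M0\<bar>}"
      by (intro closed_Collect_all closed_Collect_le continuous_intros)
    then have box: "{x :: real ^ 'd. \<forall>k. \<bar>x $ k\<bar> \<le> \<bar>M0\<bar>} \<in> sets borel" by (rule borel_closed)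
    have dens: "{x \<in> space borel. \<forall>i\<in>J. fcmin i \<le> fc i x \<and> fc i x \<le> fcmax i} \<in> sets borel"
      using J(1) by (intro sets.sets_Collect_finite_All) measurable
    have "A = {x. \<forall>k. \<bar>x $ k\<bar> \<le> \<bar>M0\<bar>} \<inter> {x \<in> space borel. \<forall>i\<in>J. fcmin i \<le> fc i x \<and> fc i x \<le> fcmax i}"
      by (auto simp: A_def)
    then show ?thesis using sets.Int[OF box dens] by simp
  qed
  have XA: "AE \<omega> in M. X \<omega> \<in> A"
    using X_range
  proof eventually_elim
    case (elim \<omega>)
    have "\<bar>X \<omega> $ k\<bar> \<le> \<bar>M0\<bar>" for k
    proof -
      have "X \<omega> $ k \<in> {- M0..M0}" using X_bounded elim by blast
      then show ?thesis by auto
    qed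
    moreover have "fcmin i \<le> fc i (X \<omega>) \<and> fc i (X \<omega>) \<le> fcmax i" if "i \<in> J" for i
      using C1(2) elim that J(2) by blast
    ultimately show ?case by (simp add: A_def)
  qed
  have YJ: "AE \<omega> in M. Y \<omega> \<in> J"
  proof -
    have "AE \<omega> in M. \<forall>i\<in>{1..Q}. Y \<omega> = i \<longrightarrow> i \<in> J"
      unfolding AE_finite_all[OF finite_atLeastAtMost]
    proof
      fix i assume i: "i \<in> {1..Q}"
      show "AE \<omega> in M. Y \<omega> = i \<longrightarrow> i \<in> J"
      proof (cases "i \<in> J")
        case False
        then have "prob {\<omega> \<in> space M. Y \<omega> = i} = 0"
          using i measure_nonneg[of M "{\<omega> \<in> space M. Y \<omega> = i}"] by (auto simp: J_def p_def)
        then have "AE \<omega> in M. Y \<omega> \<noteq> i"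
          using AE_iff_measurable[of "{\<omega> \<in> space M. Y \<omega> = i}" M "\<lambda>\<omega>. Y \<omega> \<noteq> i"]
          by (simp add: emeasure_eq_measure)
        then show ?thesis by eventually_elim simp
      qed simp
    qed
    with Y_range show ?thesis by eventually_elim auto
  qed
  have g_meas [measurable]: "g i \<in> borel_measurable borel" for i
    unfolding g_def[abs_def] by (cases "i \<in> J") auto
  \<comment> \<open>The class density describes X under the conditional measure given Y = i, and the
    class probability converts back to \<open>M\<close>. The indicator of \<open>A\<close> on the
    left matches the cut-off in \<open>g\<close>.\<close>
  have label_law: "expectation (\<lambda>\<omega>. of_bool (Y \<omega> = i) * (\<psi> (X \<omega>) * indicator A (X \<omega>))) = (\<integral>x. \<psi> x * g i x \<partial>lborel)"
    if i: "i \<in> J" and [measurable]: "\<psi> \<in> borel_measurable borel" for i \<psi>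
  proof -
    let ?S = "{\<omega> \<in> space M. Y \<omega> = i}"
    have pS: "0 < measure M ?S" using p(1)[OF i] by (simp add: p_def)
    have fc0: "0 \<le> fc i x" for x using fc_nonneg i J by auto
    have dist: "distributed (uniform_measure M ?S) lborel X (\<lambda>x. ennreal (fc i x))"
      using fc_density i J pS by auto
    have "expectation (\<lambda>\<omega>. of_bool (Y \<omega> = i) * (\<psi> (X \<omega>) * indicator A (X \<omega>)))
        = expectation (\<lambda>\<omega>. indicator ?S \<omega> * (\<psi> (X \<omega>) * indicator A (X \<omega>)))"
      by (intro Bochner_Integration.integral_cong) (auto simp: indicator_def)
    also have "\<dots> = p i * (\<integral>\<omega>. \<psi> (X \<omega>) * indicator A (X \<omega>) \<partial>uniform_measure M ?S)"
      using pS by (subst integral_uniform_measure) (auto simp: p_def)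
    also have "(\<integral>\<omega>. \<psi> (X \<omega>) * indicator A (X \<omega>) \<partial>uniform_measure M ?S)
        = (\<integral>x. fc i x * (\<psi> x * indicator A x) \<partial>lborel)"
      using fc0 by (intro distributed_integral[OF dist, symmetric]) auto
    also have "p i * \<dots> = (\<integral>x. p i * (fc i x * (\<psi> x * indicator A x)) \<partial>lborel)" by simp
    also have "\<dots> = (\<integral>x. \<psi> x * g i x \<partial>lborel)"
      using i by (intro Bochner_Integration.integral_cong) (auto simp: g_def)
    finally show ?thesis .
  qed
  \<comment> \<open>The absolute value supplies the nonnegative box radius without a case
    distinction on the sign of \<open>M0\<close>.\<close>
  interpret D: label_densities M Z0 Z J A g B' "\<bar>M0\<bar>"
  proof unfold_locales
    show "Z0 \<in> measurable M (borel \<Otimes>\<^sub>M count_space UNIV)"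
      unfolding Z0_def[abs_def] by measurable
    show "indep_vars (\<lambda>_. borel \<Otimes>\<^sub>M count_space UNIV) Z {1..}"
      using indep by (simp add: Z_def[abs_def])
    show "distr M (borel \<Otimes>\<^sub>M count_space UNIV) (Z l) = distr M (borel \<Otimes>\<^sub>M count_space UNIV) Z0" if "l \<ge> 1" for l
      using ident[OF that] by (simp add: Z_def[abs_def] Z0_def[abs_def])
    show "0 \<le> g i x" for i x
      using p fc_nonneg J by (auto simp: g_def less_imp_le intro!: mult_nonneg_nonneg)
    have Bi: "\<bar>fcmax i\<bar> \<le> B'" if "i \<in> J" for i
      unfolding B'_def using that J by (intro member_le_sum) auto
    show "g i x \<le> B'" for i x
    proof (cases "i \<in> J \<and> x \<in> A")
      case True
      then have "g i x = p i * fc i x" by (simp add: g_def)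
      also have "\<dots> \<le> 1 * \<bar>fcmax i\<bar>"
        using True p fc_nonneg J by (intro mult_mono) (auto simp: A_def intro: order.trans[OF _ abs_ge_self])
      finally show ?thesis using Bi True by force
    next
      case False
      then show ?thesis by (auto simp: g_def B'_def sum_nonneg)
    qed
    show "expectation (\<lambda>\<omega>. \<phi> (Z0 \<omega>)) = (\<Sum>i\<in>J. \<integral>x. \<phi> (x, i) * g i x \<partial>lborel)"
      if \<phi> [measurable]: "\<phi> \<in> borel_measurable (borel \<Otimes>\<^sub>M count_space UNIV)" and b: "\<And>z. \<bar>\<phi> z\<bar> \<le> b" for \<phi> b
    proof -
      have \<phi>i [measurable]: "(\<lambda>x. \<phi> (x, i)) \<in> borel_measurable borel" for i
        by (rule measurable_compose[OF _ \<phi>]) simp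
      have b0: "0 \<le> b" using b[of undefined] by linarith
      have int: "integrable M (\<lambda>\<omega>. of_bool (Y \<omega> = i) * (\<phi> (X \<omega>, i) * indicator A (X \<omega>)))" for i
        using b b0 by (intro integrable_const_bound[where B = b]) (auto simp: of_bool_def split: split_indicator)
      \<comment> \<open>Splitting by the value of Y, which lies in \<open>J\<close> almost surely,
        reduces a test function of the pair to functions of X alone. The indicator may be inserted
        because X lies in \<open>A\<close> almost surely.\<close>
      have "expectation (\<lambda>\<omega>. \<phi> (Z0 \<omega>)) = expectation (\<lambda>\<omega>. \<Sum>i\<in>J. of_bool (Y \<omega> = i) * (\<phi> (X \<omega>, i) * indicator A (X \<omega>)))"
      proof (rule integral_cong_AE)
        show "AE \<omega> in M. \<phi> (Z0 \<omega>) = (\<Sum>i\<in>J. of_bool (Y \<omega> = i) * (\<phi> (X \<omega>, i) * indicator A (X \<omega>)))"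
          using XA YJ
        proof eventually_elim
          case (elim \<omega>)
          have "(\<Sum>i\<in>J. of_bool (Y \<omega> = i) * (\<phi> (X \<omega>, i) * indicator A (X \<omega>))) = (\<Sum>i\<in>J. if i = Y \<omega> then \<phi> (X \<omega>, i) else 0)"
            using elim by (intro sum.cong) auto
          then show ?case using elim J by (simp add: Z0_def)
        qed
        show "(\<lambda>\<omega>. \<phi> (Z0 \<omega>)) \<in> borel_measurable M" unfolding Z0_def by measurable
      qed measurable
      also have "\<dots> = (\<Sum>i\<in>J. expectation (\<lambda>\<omega>. of_bool (Y \<omega> = i) * (\<phi> (X \<omega>, i) * indicator A (X \<omega>))))"
        using int by (intro Bochner_Integration.integral_sum)
      also have "\<dots> = (\<Sum>i\<in>J. \<integral>x. \<phi> (x, i) * g i x \<partial>lborel)"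
        by (intro sum.cong label_law) auto
      finally show ?thesis .
    qed
  qed (use J in \<open>auto simp: g_def A_def\<close>)
  have supp: "AE \<omega> in M. fst (Z0 \<omega>) \<in> A \<and> snd (Z0 \<omega>) \<in> J"
    using XA YJ by eventually_elim (simp add: Z0_def)
  have "AE \<omega> in M. \<forall>\<^sub>F n in sequentially.
    \<forall>F. plugin_classifier Q n (h n) (\<lambda>l. Xs l \<omega>) (\<lambda>l. Ys l \<omega>) F \<longrightarrow>
      misclassification_error M X Y F
        \<le> 2 * ((\<Sum>l = 1..n. \<Sum>m = 1..n. theta (Ys l \<omega>) (Ys m \<omega>) *
              G_sim n (h n) (\<lambda>l. Xs l \<omega>) (Xs l \<omega>) (Xs m \<omega>)) / (real n)\<^sup>2)"
  proof (cases "\<forall>i\<in>J. \<exists>j\<in>J. j \<noteq> i")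
    case True
    \<comment> \<open>The extra element 1 keeps the minimum defined without first showing that
      \<open>J\<close> is nonempty.\<close>
    define c0 where "c0 = Min (insert 1 ((\<lambda>i. p i * fcmin i) ` J))"
    have "0 < p i * fcmin i" if "i \<in> J" for i
      using that p C1(1) J(2) by (intro mult_pos_pos) auto
    then have "0 < c0" using J(1) by (simp add: c0_def)
    moreover have "c0 \<le> g i x" if "i \<in> J" "x \<in> A" for i x
    proof -
      have "c0 \<le> p i * fcmin i" unfolding c0_def using that J by (intro Min_le) auto
      also have "\<dots> \<le> p i * fc i x" using that p by (intro mult_left_mono) (auto simp: A_def less_imp_le)
      finally show ?thesis using that by (simp add: g_def)
    qed
    ultimately show ?thesis
      using D.plugin_risk_AE[OF B C2(1) J(2) _ _ _ supp, of c0] True by (simp add: Z0_def Z_def)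
  next
    case False
    \<comment> \<open>Almost surely all training labels are then k, so the rule is constantly k,
      while the similarity sum is nonnegative.\<close>
    then obtain k where k: "J = {k}" by auto
    have "AE \<omega> in M. \<forall>l\<ge>1. snd (Z l \<omega>) \<in> J"
      using supp by (intro D.AE_sample) (auto elim: eventually_mono)
    then show ?thesis
    proof eventually_elim
      case (elim \<omega>)
      show ?case
        using eventually_ge_at_top[of 1]
      proof eventually_elim
        case n: (elim n)
        have hn: "0 < h n" using B n by (simp add: bandwidth_condition_def)
        show ?case
        proof (intro allI impI)
          fix F assume F: "plugin_classifier Q n (h n) (\<lambda>l. Xs l \<omega>) (\<lambda>l. Ys l \<omega>) F"
          have "F x \<in> J" for x
            by (rule plugin_classifier_observed_label[OF F n hn _ J(2)]) (use elim in \<open>auto simp: Z_def\<close>)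
          then have Fk: "F x = k" for x using k by simp
          have "AE \<omega> in M. k = Y \<omega>" using YJ by eventually_elim (auto simp: k)
          then have "misclassification_error M X Y F = 0"
            unfolding misclassification_error_def Fk
            using AE_iff_measurable[of "{\<omega> \<in> space M. k \<noteq> Y \<omega>}" M "\<lambda>\<omega>. k = Y \<omega>"]
            by (simp add: emeasure_eq_measure)
          moreover have "0 \<le> (\<Sum>l = 1..n. \<Sum>m = 1..n. theta (Ys l \<omega>) (Ys m \<omega>) *
              G_sim n (h n) (\<lambda>l. Xs l \<omega>) (Xs l \<omega>) (Xs m \<omega>))"
            using G_sim_nonneg[OF n hn] by (intro sum_nonneg mult_nonneg_nonneg) (auto simp: theta_def)
          ultimately show "misclassification_error M X Y F
              \<le> 2 * ((\<Sum>l = 1..n. \<Sum>m = 1..n. theta (Ys l \<omega>) (Ys m \<omega>) *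
                G_sim n (h n) (\<lambda>l. Xs l \<omega>) (Xs l \<omega>) (Xs m \<omega>)) / (real n)\<^sup>2)" by simp
        qed
      qed
    qed
  qed
  then show ?thesis by (intro exI[of _ 0]) simp
qed

end
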